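(* Let $a_0\in\mathbb{D}$, $a_1,b\in\mathbb{C}$, $\psi(z)=\frac{b}{1-a_0z}$ and $\varphi(z)=a_0+\frac{a_1z}{1-a_0z}$, where $\varphi$ is an analytic self-map of $\mathbb{D}$ that is not an automorphism of $\mathbb{D}$. Let $\lambda$ be a constant with $|\lambda|=1$, and put $\widetilde\psi(z)=\psi(\lambda z)$ and $\widetilde\varphi(z)=\varphi(\lambda z)$. If $\varphi(\lambda\zeta)\neq\zeta$ for each $\zeta\in\partial\mathbb{D}$, then $$\sigma(C_{\widetilde\psi,\widetilde\varphi})=\{\psi(\lambda w)(\lambda\varphi'(\lambda w))^n : n=0,1,\dots\}$$ and $r(C_{\widetilde\psi,\widetilde\varphi})=|\psi(\lambda w)|$, where $w\in\mathbb{D}$ and $\varphi(\lambda w)=w$.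
   Context: $\mathbb{D}$ is the open unit disk and $H^2$ is the Hardy space on $\mathbb{D}$. $(C_{\psi,\varphi}f)(z)=\psi(z)f(\varphi(z))$ is the weighted composition operator, acting on $H^2$. $\sigma(T)$ and $r(T)$ denote the spectrum and spectral radius of $T$.
   Formalization: The spectrum is stated as {0} together with the numbers ψ(λw)(λφ'(λw))^n; the printed set omits 0 and is false when b and a_1 are nonzero, e.g. a_0=0, a_1=1/2, b=λ=1, where {2^-n} is not closed. *)

theory Defs
  imports "HOL-Complex_Analysis.Complex_Analysis"
begin

abbreviation unit_disk :: "complex set" where
  "unit_disk \<equiv> ball 0 1"

definition hardy_mean :: "(complex \<Rightarrow> complex) \<Rightarrow> real \<Rightarrow> real" where
  "hardy_mean f r = integral {0..2 * pi} (\<lambda>t. (cmod (f (rcis r t)))\<^sup>2) / (2 * pi)"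

text \<open>An element of the Hardy space is a function on the disk. It is represented by the total
  function that vanishes off the disk, so that equality of elements is equality in HOL and the
  vector space operations are the pointwise ones.\<close>

definition hardy2 :: "(complex \<Rightarrow> complex) set" where
  "hardy2 = {f. f holomorphic_on unit_disk \<and> (\<forall>z. z \<notin> unit_disk \<longrightarrow> f z = 0) \<and>
                bdd_above (hardy_mean f ` {0..<1})}"

definition hardy2_norm :: "(complex \<Rightarrow> complex) \<Rightarrow> real" where
  "hardy2_norm f = sqrt (SUP r\<in>{0..<1}. hardy_mean f r)"

definition hardy2_bounded_op :: "((complex \<Rightarrow> complex) \<Rightarrow> complex \<Rightarrow> complex) \<Rightarrow> bool" where
  "hardy2_bounded_op T \<longleftrightarrow>
     (\<forall>f\<in>hardy2. T f \<in> hardy2) \<and>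
     (\<forall>f\<in>hardy2. \<forall>g\<in>hardy2. T (\<lambda>z. f z + g z) = (\<lambda>z. T f z + T g z)) \<and>
     (\<forall>f\<in>hardy2. \<forall>c. T (\<lambda>z. c * f z) = (\<lambda>z. c * T f z)) \<and>
     (\<exists>K. \<forall>f\<in>hardy2. hardy2_norm (T f) \<le> K * hardy2_norm f)"

definition hardy2_invertible_op :: "((complex \<Rightarrow> complex) \<Rightarrow> complex \<Rightarrow> complex) \<Rightarrow> bool" where
  "hardy2_invertible_op T \<longleftrightarrow>
     hardy2_bounded_op T \<and>
     (\<exists>S. hardy2_bounded_op S \<and> (\<forall>f\<in>hardy2. S (T f) = f \<and> T (S f) = f))"

text \<open>Invertibility includes boundedness, so an operator that is not bounded on the Hardy space
  has the whole plane as its spectrum.\<close>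

definition hardy2_spectrum :: "((complex \<Rightarrow> complex) \<Rightarrow> complex \<Rightarrow> complex) \<Rightarrow> complex set" where
  "hardy2_spectrum T = {\<mu>. \<not> hardy2_invertible_op (\<lambda>f z. T f z - \<mu> * f z)}"

definition hardy2_spectral_radius :: "((complex \<Rightarrow> complex) \<Rightarrow> complex \<Rightarrow> complex) \<Rightarrow> real" where
  "hardy2_spectral_radius T = (SUP \<mu>\<in>hardy2_spectrum T. cmod \<mu>)"

definition weighted_comp ::
    "(complex \<Rightarrow> complex) \<Rightarrow> (complex \<Rightarrow> complex) \<Rightarrow> (complex \<Rightarrow> complex) \<Rightarrow> complex \<Rightarrow> complex" where
  "weighted_comp \<psi> \<phi> f = (\<lambda>z. if z \<in> unit_disk then \<psi> z * f (\<phi> z) else 0)"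

definition analytic_self_map :: "(complex \<Rightarrow> complex) \<Rightarrow> bool" where
  "analytic_self_map \<phi> \<longleftrightarrow> \<phi> holomorphic_on unit_disk \<and> \<phi> ` unit_disk \<subseteq> unit_disk"

text \<open>The inverse of a holomorphic bijection of the disk is automatically holomorphic.\<close>

definition disk_automorphism :: "(complex \<Rightarrow> complex) \<Rightarrow> bool" where
  "disk_automorphism \<phi> \<longleftrightarrow> \<phi> holomorphic_on unit_disk \<and> bij_betw \<phi> unit_disk unit_disk"

end

theory Submission imports Defs begin

text \<open>
  Write \<open>T f = u * (f \<circ> \<tau>)\<close> with \<open>\<tau> z = \<phi> (l * z)\<close>. If \<open>\<tau> \<circ> \<tau>\<close> sent a point of the unit circle to the circle, then \<open>\<phi>\<close>
  would have two distinct points of contact with the circle, hence be an automorphism. So \<open>\<tau> \<circ> \<tau>\<close> maps the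
  closed disk into a smaller disk, and by the Schwarz lemma it contracts the pseudo-hyperbolic
  distance to the fixed point \<open>w\<close> by some factor \<open>r < 1\<close>.

  On functions vanishing to order \<open>N\<close> at \<open>w\<close> the powers of \<open>T\<^sup>2\<close> then decay like \<open>(B\<^sup>2 r ^ N) ^ m\<close>, where \<open>B\<close>
  bounds \<open>u\<close>, so for \<open>\<mu> \<noteq> 0\<close> and large \<open>N\<close> the Neumann series inverts \<open>T - \<mu>\<close> there. On functions of the form
  \<open>(z - w) ^ N * G z\<close>, \<open>T\<close> multiplies \<open>G w\<close> by \<open>u w * deriv \<tau> w ^ N\<close>; hence \<open>T - \<mu>\<close> can be inverted one order
  at a time down to \<open>N = 0\<close> exactly when \<open>\<mu>\<close> is none of these numbers. This replaces the Riesz theory of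
  the compact operator \<open>T\<^sup>2\<close>.
\<close>

section \<open>The Poisson kernel and subordination\<close>

text \<open>Cauchy's integral formula read along \<open>rcis R t\<close>; the factor
  \<open>\<i>\<close> from the derivative of the path cancels against the one in the
  constant.\<close>

lemma circle_mean_Cauchy:
  fixes F :: "complex \<Rightarrow> complex"
  assumes "continuous_on (cball 0 R) F" "F holomorphic_on ball 0 R" "cmod \<zeta> < R"
  shows "((\<lambda>t. F (rcis R t) * rcis R t / (rcis R t - \<zeta>)) has_integral 2 * pi * F \<zeta>) {0..2 * pi}"
proof -
  have "((\<lambda>u. F u / (u - \<zeta>)) has_contour_integral (2 * of_real pi * \<i> * F \<zeta>)) (circlepath 0 R)"
    using assms by (intro Cauchy_integral_circlepath) auto
  then have "((\<lambda>t. F (R * cis t) / (R * cis t - \<zeta>) * R * \<i> * cis t)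
      has_integral 2 * of_real pi * \<i> * F \<zeta>) {0..2 * pi}"
    by (simp add: circlepath_def has_contour_integral_part_circlepath_iff)
  from has_integral_mult_right[OF this, of "- \<i>"] show ?thesis
    by (simp add: rcis_def field_simps)
qed

text \<open>The Poisson kernel of the disk of radius \<open>R\<close> without the factor 1 / (2 pi).
  As the real part of the Herglotz kernel it is visibly harmonic in \<open>\<zeta>\<close>;
  \<open>poisson_eq\<close> gives the quotient form that shows its sign.\<close>

definition poisson :: "real \<Rightarrow> complex \<Rightarrow> real \<Rightarrow> real" where
  "poisson R \<zeta> t = Re ((rcis R t + \<zeta>) / (rcis R t - \<zeta>))"

lemma poisson_eq:
  assumes "R \<ge> 0"
  shows "poisson R \<zeta> t = (R\<^sup>2 - (cmod \<zeta>)\<^sup>2) / (cmod (rcis R t - \<zeta>))\<^sup>2"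
proof -
  have "(cmod (rcis R t))\<^sup>2 = R\<^sup>2" using assms by simp
  then have "Re ((rcis R t + \<zeta>) * cnj (rcis R t - \<zeta>)) = R\<^sup>2 - (cmod \<zeta>)\<^sup>2"
    unfolding cmod_power2 by (simp add: algebra_simps power2_eq_square)
  then show ?thesis
    unfolding poisson_def by (subst complex_div_cnj) (simp add: Re_divide_of_real)
qed

lemma poisson_nonneg: "cmod \<zeta> < R \<Longrightarrow> poisson R \<zeta> t \<ge> 0"
  by (subst poisson_eq) (use norm_ge_zero[of \<zeta>] in \<open>auto intro!: divide_nonneg_nonneg power_mono simp: less_imp_le simp del: norm_ge_zero\<close>)

lemma poisson_le:
  assumes "cmod \<zeta> < R"
  shows "poisson R \<zeta> t \<le> (R + cmod \<zeta>) / (R - cmod \<zeta>)"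
proof -
  have R: "R > 0" using assms norm_ge_zero[of \<zeta>] by linarith
  have "poisson R \<zeta> t \<le> cmod ((rcis R t + \<zeta>) / (rcis R t - \<zeta>))"
    unfolding poisson_def by (rule complex_Re_le_cmod)
  also have "\<dots> = cmod (rcis R t + \<zeta>) / cmod (rcis R t - \<zeta>)" by (rule norm_divide)
  also have "\<dots> \<le> (R + cmod \<zeta>) / (R - cmod \<zeta>)"
    using norm_triangle_ineq[of "rcis R t" \<zeta>] norm_triangle_ineq2[of "rcis R t" \<zeta>] assms R
    by (intro frac_le) auto
  finally show ?thesis .
qed

lemma rcis_minus_nonzero: "cmod \<zeta> < R \<Longrightarrow> rcis R t - \<zeta> \<noteq> 0"
  by (smt (verit) complex_mod_rcis eq_iff_diff_eq_0 norm_ge_zero)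

lemma continuous_on_rcis [continuous_intros]: "continuous_on S (rcis r)"
  unfolding rcis_def by (intro continuous_intros)

lemma continuous_on_rcis_comp:
  assumes "continuous_on (cball 0 r) f" "0 \<le> r"
  shows "continuous_on S (\<lambda>t. f (rcis r t))"
  by (rule continuous_on_compose2[OF assms(1)]) (use assms in \<open>auto intro: continuous_intros\<close>)

lemma continuous_on_poisson: "cmod \<zeta> < R \<Longrightarrow> continuous_on S (poisson R \<zeta>)"
  unfolding poisson_def
  by (intro continuous_intros) (auto dest: rcis_minus_nonzero)

lemma continuous_on_sq_rcis:
  assumes "f holomorphic_on unit_disk" "0 \<le> r" "r < 1"
  shows "continuous_on S (\<lambda>t. (cmod (f (rcis r t)))\<^sup>2)"
proof -
  have "continuous_on (cball 0 r) f"
    using assms by (intro holomorphic_on_imp_continuous_on holomorphic_on_subset[OF assms(1)]) auto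
  then show ?thesis using assms by (intro continuous_intros continuous_on_rcis_comp)
qed

text \<open>Apply Cauchy's formula to \<open>g z * (R\<^sup>2 - |\<zeta>|\<^sup>2) / (R\<^sup>2 - cnj \<zeta> * z)\<close>, which agrees with \<open>g\<close> at
  \<open>\<zeta>\<close> and turns the Cauchy kernel into the Poisson kernel on the circle of radius \<open>R\<close>.\<close>

lemma poisson_formula:
  fixes g :: "complex \<Rightarrow> complex"
  assumes cont: "continuous_on (cball 0 R) g" and hol: "g holomorphic_on ball 0 R"
    and z: "cmod \<zeta> < R"
  shows "((\<lambda>t. g (rcis R t) * poisson R \<zeta> t) has_integral 2 * pi * g \<zeta>) {0..2 * pi}"
proof -
  have R: "R > 0" using z norm_ge_zero[of \<zeta>] by linarith
  have lt: "(cmod \<zeta>)\<^sup>2 < R\<^sup>2" using z by (intro power_strict_mono) auto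
  define F where "F = (\<lambda>z. g z * (R\<^sup>2 - (cmod \<zeta>)\<^sup>2) / (R\<^sup>2 - cnj \<zeta> * z))"
  have nz: "complex_of_real R ^ 2 - cnj \<zeta> * z \<noteq> 0" if "cmod z \<le> R" for z
  proof
    assume "complex_of_real R ^ 2 - cnj \<zeta> * z = 0"
    then have "cmod (cnj \<zeta> * z) = cmod (complex_of_real R ^ 2)" by simp
    then have "cmod \<zeta> * cmod z = R ^ 2" by (simp add: norm_mult norm_power)
    moreover have "cmod \<zeta> * cmod z \<le> cmod \<zeta> * R" using that by (intro mult_left_mono) auto
    moreover have "cmod \<zeta> * R < R * R" using z R by (intro mult_strict_right_mono)
    ultimately show False by (simp add: power2_eq_square)
  qed
  have "continuous_on (cball 0 R) F" unfolding F_def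
    by (intro continuous_intros cont) (use nz in auto)
  moreover have "F holomorphic_on ball 0 R" unfolding F_def
    by (intro holomorphic_intros hol) (use nz in \<open>auto simp: less_imp_le\<close>)
  ultimately have "((\<lambda>t. F (rcis R t) * rcis R t / (rcis R t - \<zeta>)) has_integral 2 * pi * F \<zeta>) {0..2 * pi}"
    using z by (rule circle_mean_Cauchy)
  moreover have "F \<zeta> = g \<zeta>"
  proof -
    have "cnj \<zeta> * \<zeta> = complex_of_real (cmod \<zeta>) ^ 2"
      using complex_norm_square[of \<zeta>] by (simp add: mult.commute[of "cnj \<zeta>"])
    moreover have "complex_of_real R ^ 2 - complex_of_real (cmod \<zeta>) ^ 2 \<noteq> 0"
    proof -
      have "complex_of_real R ^ 2 - complex_of_real (cmod \<zeta>) ^ 2 = of_real (R\<^sup>2 - (cmod \<zeta>)\<^sup>2)" by simp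
      then show ?thesis using lt by (simp only: of_real_eq_0_iff)
    qed
    ultimately show ?thesis unfolding F_def by simp
  qed
  moreover have "F (rcis R t) * rcis R t / (rcis R t - \<zeta>) = g (rcis R t) * poisson R \<zeta> t" for t
  proof -
    define y where "y = rcis R t"
    have y0: "y \<noteq> 0" using R by (simp add: y_def)
    have yz: "y - \<zeta> \<noteq> 0" using rcis_minus_nonzero[OF z] by (simp add: y_def)
    then have cyz: "cnj y - cnj \<zeta> \<noteq> 0" by (metis complex_cnj_cancel_iff eq_iff_diff_eq_0)
    have "cmod y = R" using R by (simp add: y_def)
    then have "complex_of_real R ^ 2 = y * cnj y" using complex_norm_square[of y] by simp
    then have "complex_of_real R ^ 2 - cnj \<zeta> * y = y * (cnj y - cnj \<zeta>)" by (simp add: algebra_simps)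
    then have "F y * y / (y - \<zeta>) = g y * (of_real (R\<^sup>2 - (cmod \<zeta>)\<^sup>2) / ((y - \<zeta>) * (cnj y - cnj \<zeta>)))"
      unfolding F_def using y0 yz cyz by (simp add: divide_simps)
    also have "(y - \<zeta>) * (cnj y - cnj \<zeta>) = of_real ((cmod (y - \<zeta>))\<^sup>2)"
      using complex_norm_square[of "y - \<zeta>"] by simp
    finally show ?thesis using R by (simp add: poisson_eq y_def)
  qed
  ultimately show ?thesis by simp
qed

text \<open>The Poisson formula is applied to the square of \<open>f\<close>, which is again
  holomorphic; the kernel is nonnegative and so survives taking absolute values under the
  integral.\<close>

lemma cmod_sq_le_poisson:
  assumes hol: "f holomorphic_on unit_disk" and z: "cmod \<zeta> < R" and R: "R < 1"
  shows "(cmod (f \<zeta>))\<^sup>2 \<le> integral {0..2 * pi} (\<lambda>t. poisson R \<zeta> t * (cmod (f (rcis R t)))\<^sup>2) / (2 * pi)"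
proof -
  have R0: "R > 0" using z norm_ge_zero[of \<zeta>] by linarith
  have holR: "f holomorphic_on cball 0 R" using hol R by (auto intro: holomorphic_on_subset)
  have I: "((\<lambda>t. (f (rcis R t))\<^sup>2 * poisson R \<zeta> t) has_integral 2 * pi * (f \<zeta>)\<^sup>2) {0..2 * pi}"
    by (rule poisson_formula[where g = "\<lambda>z. (f z)\<^sup>2"])
       (use holR z in \<open>auto intro!: continuous_intros holomorphic_intros holomorphic_on_imp_continuous_on
          intro: holomorphic_on_subset\<close>)
  have "norm (integral {0..2 * pi} (\<lambda>t. (f (rcis R t))\<^sup>2 * poisson R \<zeta> t))
      \<le> integral {0..2 * pi} (\<lambda>t. poisson R \<zeta> t * (cmod (f (rcis R t)))\<^sup>2)"
  proof (rule integral_norm_bound_integral)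
    show "(\<lambda>t. poisson R \<zeta> t * (cmod (f (rcis R t)))\<^sup>2) integrable_on {0..2 * pi}"
      using hol R R0 z
      by (intro integrable_continuous_interval continuous_on_mult continuous_on_poisson continuous_on_sq_rcis) auto
  qed (use I poisson_nonneg[OF z] in \<open>auto simp: norm_mult norm_power mult.commute\<close>)
  moreover have "integral {0..2 * pi} (\<lambda>t. (f (rcis R t))\<^sup>2 * poisson R \<zeta> t) = 2 * pi * (f \<zeta>)\<^sup>2"
    using I by (rule integral_unique)
  ultimately show ?thesis by (simp add: norm_mult norm_power field_simps)
qed

lemma poisson_mean_comp:
  assumes tau: "\<tau> holomorphic_on unit_disk" and r: "0 \<le> r" "r < 1"
    and less: "\<And>z. cmod z \<le> r \<Longrightarrow> cmod (\<tau> z) < R"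
  shows "integral {0..2 * pi} (\<lambda>s. poisson R (\<tau> (rcis r s)) t) = 2 * pi * poisson R (\<tau> 0) t"
proof (cases "r = 0")
  \<comment> \<open>On a circle of radius 0 the integrand is constant; the Cauchy formula used below
    needs the center strictly inside the circle.\<close>
  case True
  then show ?thesis by simp
next
  case False
  define y where "y = rcis R t"
  define q where "q = (\<lambda>z. (y + \<tau> z) / (y - \<tau> z))"
  have nz: "y - \<tau> z \<noteq> 0" if "cmod z \<le> r" for z
    using rcis_minus_nonzero[OF less[OF that]] by (simp add: y_def)
  have hol: "q holomorphic_on cball 0 r" unfolding q_def
    by (intro holomorphic_intros holomorphic_on_subset[OF tau]) (use r nz in auto)
  have "((\<lambda>s. q (rcis r s) * rcis r s / (rcis r s - 0)) has_integral 2 * pi * q 0) {0..2 * pi}"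
    by (rule circle_mean_Cauchy)
       (use hol r False in \<open>auto intro: holomorphic_on_subset intro!: holomorphic_on_imp_continuous_on\<close>)
  then have "((\<lambda>s. q (rcis r s)) has_integral 2 * pi * q 0) {0..2 * pi}"
    using False by simp
  then have "((\<lambda>s. Re (q (rcis r s))) has_integral 2 * pi * Re (q 0)) {0..2 * pi}"
    by (auto dest: has_integral_Re)
  then show ?thesis
    by (intro integral_unique) (simp add: q_def y_def poisson_def)
qed

text \<open>Littlewood subordination: \<open>\<zeta> \<mapsto> poisson R \<zeta> t\<close> is the real part of a holomorphic function, so its mean
  along the image of a circle under \<open>\<tau>\<close> is its value at \<open>\<tau> 0\<close>.\<close>

lemma hardy_mean_comp_le:
  assumes f: "f holomorphic_on unit_disk" and tau: "analytic_self_map \<tau>" and r: "0 \<le> r" "r < 1"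
  shows "\<exists>R\<in>{0..<1}. hardy_mean (\<lambda>z. f (\<tau> z)) r \<le> 4 / (1 - cmod (\<tau> 0)) * hardy_mean f R"
proof -
  have th: "\<tau> holomorphic_on unit_disk" and ti: "\<And>z. cmod z < 1 \<Longrightarrow> cmod (\<tau> z) < 1"
    using tau by (auto simp: analytic_self_map_def image_subset_iff)
  have tc: "continuous_on (cball 0 r) \<tau>"
    using r by (intro holomorphic_on_imp_continuous_on holomorphic_on_subset[OF th]) auto
  have "continuous_on (cball 0 r) (\<lambda>z. cmod (\<tau> z))"
    by (intro continuous_intros tc)
  then obtain z0 where z0: "z0 \<in> cball 0 r" "\<And>z. z \<in> cball 0 r \<Longrightarrow> cmod (\<tau> z) \<le> cmod (\<tau> z0)"
    using continuous_attains_sup[of "cball 0 r" "\<lambda>z. cmod (\<tau> z)"] r by auto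
  \<comment> \<open>The circle of radius \<open>R\<close> must enclose the image of the disk of
    radius \<open>r\<close>. Taking \<open>R\<close> above the midpoint of |\<tau> 0| and 1 also
    keeps \<open>R - cmod (\<tau> 0)\<close> above half of \<open>1 - cmod (\<tau> 0)\<close>, so
    the final constant does not depend on \<open>r\<close>.\<close>
  obtain R where R: "max ((1 + cmod (\<tau> 0)) / 2) (cmod (\<tau> z0)) < R" "R < 1"
    using dense[of "max ((1 + cmod (\<tau> 0)) / 2) (cmod (\<tau> z0))" 1] ti[of 0] ti[of z0] z0 r by auto
  have R0: "0 < R" using R by (smt (verit) norm_ge_zero divide_nonneg_nonneg)
  have less: "cmod (\<tau> z) < R" if "cmod z \<le> r" for z
    using z0(2)[of z] that R by auto
  have t0: "cmod (\<tau> 0) < R" using less r by simp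
  let ?P = "\<lambda>s t. poisson R (\<tau> (rcis r s)) t * (cmod (f (rcis R t)))\<^sup>2"
  have ls: "cmod (\<tau> (rcis r s)) < R" for s using less r by simp
  have contP: "continuous_on S (\<lambda>(s, t). ?P s t)" for S
  proof -
    have "continuous_on S (\<lambda>x. \<tau> (rcis r (fst x)))"
      by (rule continuous_on_compose2[OF tc]) (use r in \<open>auto simp: rcis_def norm_mult intro!: continuous_intros\<close>)
    moreover have "continuous_on S (\<lambda>x. rcis R (snd x))"
      unfolding rcis_def by (intro continuous_intros)
    moreover from this have "continuous_on S (\<lambda>x. f (rcis R (snd x)))"
      by (rule continuous_on_compose2[OF holomorphic_on_imp_continuous_on[OF f]]) (use R R0 in auto)
    ultimately show ?thesis unfolding split_beta poisson_def
      by (intro continuous_intros) (use rcis_minus_nonzero[OF ls] in auto)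
  qed
  have contI: "continuous_on {0..2*pi} (\<lambda>s. integral {0..2 * pi} (?P s))"
    using integral_continuous_on_param[of "{0..2*pi}" 0 "2*pi" ?P] contP by auto
  have fc: "(\<lambda>z. f (\<tau> z)) holomorphic_on unit_disk"
    using holomorphic_on_compose_gen[OF th f] ti by (auto simp: o_def image_subset_iff)
  have "integral {0..2 * pi} (\<lambda>s. (cmod (f (\<tau> (rcis r s))))\<^sup>2)
      \<le> integral {0..2 * pi} (\<lambda>s. integral {0..2 * pi} (?P s) / (2 * pi))"
  proof (rule integral_le)
    show "(\<lambda>s. (cmod (f (\<tau> (rcis r s))))\<^sup>2) integrable_on {0..2 * pi}"
      using continuous_on_sq_rcis[OF fc r] by (intro integrable_continuous_interval)
    show "(\<lambda>s. integral {0..2 * pi} (?P s) / (2 * pi)) integrable_on {0..2 * pi}"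
      by (intro integrable_continuous_interval continuous_intros contI) auto
    show "(cmod (f (\<tau> (rcis r s))))\<^sup>2 \<le> integral {0..2 * pi} (?P s) / (2 * pi)" for s
      using cmod_sq_le_poisson[OF f ls] R by auto
  qed
  also have "\<dots> = integral {0..2 * pi} (\<lambda>s. integral {0..2 * pi} (?P s)) / (2 * pi)"
    by simp
  \<comment> \<open>After the swap the inner integral is a mean of the Poisson kernel along the
    image of a circle, which \<open>poisson_mean_comp\<close> evaluates.\<close>
  also have "integral {0..2 * pi} (\<lambda>s. integral {0..2 * pi} (?P s)) =
      integral {0..2 * pi} (\<lambda>t. integral {0..2 * pi} (\<lambda>s. ?P s t))"
    using integral_swap_continuous[of 0 0 "2*pi" "2*pi" ?P] contP by simp
  also have "\<dots> = integral {0..2 * pi} (\<lambda>t. 2 * pi * (poisson R (\<tau> 0) t * (cmod (f (rcis R t)))\<^sup>2))"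
    using poisson_mean_comp[OF th r less] by (simp add: mult.assoc)
  also have "\<dots> = 2 * pi * integral {0..2 * pi} (\<lambda>t. poisson R (\<tau> 0) t * (cmod (f (rcis R t)))\<^sup>2)"
    by simp
  also have "\<dots> / (2 * pi) \<le> integral {0..2 * pi} (\<lambda>t. 4 / (1 - cmod (\<tau> 0)) * (cmod (f (rcis R t)))\<^sup>2)"
  proof -
    have c: "continuous_on {0..2*pi} (\<lambda>t. (cmod (f (rcis R t)))\<^sup>2)"
      using f R R0 by (intro continuous_on_sq_rcis) auto
    have "(R + cmod (\<tau> 0)) / (R - cmod (\<tau> 0)) \<le> 2 / ((1 - cmod (\<tau> 0)) / 2)"
      using R t0 ti[of 0] by (intro frac_le) auto
    then have "poisson R (\<tau> 0) t \<le> 4 / (1 - cmod (\<tau> 0))" for t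
      using poisson_le[OF t0, of t] by simp
    then have "integral {0..2 * pi} (\<lambda>t. poisson R (\<tau> 0) t * (cmod (f (rcis R t)))\<^sup>2) \<le>
      integral {0..2 * pi} (\<lambda>t. 4 / (1 - cmod (\<tau> 0)) * (cmod (f (rcis R t)))\<^sup>2)"
      by (intro integral_le integrable_continuous_interval continuous_on_mult c continuous_on_poisson t0
          mult_right_mono continuous_intros) auto
    then show ?thesis by simp
  qed
  finally have "hardy_mean (\<lambda>z. f (\<tau> z)) r \<le> 4 / (1 - cmod (\<tau> 0)) * hardy_mean f R"
    unfolding hardy_mean_def times_divide_eq_right by (intro divide_right_mono) auto
  then show ?thesis using R R0 by auto
qed

text \<open>Subordination for the constant self-map with value \<open>\<zeta>\<close>: the composite
  is the constant \<open>f \<zeta>\<close>, whose mean is its squared modulus.\<close>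

lemma cmod_sq_le_hardy_mean:
  assumes f: "f holomorphic_on unit_disk" and z: "cmod \<zeta> < 1"
  shows "\<exists>R\<in>{0..<1}. (cmod (f \<zeta>))\<^sup>2 \<le> 4 / (1 - cmod \<zeta>) * hardy_mean f R"
  using hardy_mean_comp_le[OF f, of "\<lambda>_. \<zeta>" 0] z
  by (simp add: analytic_self_map_def hardy_mean_def image_subset_iff)

section \<open>The Hardy space\<close>

lemma hardy_mean_nonneg: "hardy_mean f r \<ge> 0"
  unfolding hardy_mean_def
  \<comment> \<open>For arbitrary \<open>f\<close> the integrand may fail to be integrable; its
    integral is then 0 by convention.\<close>
  by (cases "(\<lambda>t. (cmod (f (rcis r t)))\<^sup>2) integrable_on {0..2 * pi}")
     (auto intro!: divide_nonneg_nonneg integral_nonneg simp: not_integrable_integral)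

lemma hardy_mean_le_const:
  assumes "f holomorphic_on unit_disk" "0 \<le> r" "r < 1" "\<And>z. cmod z < 1 \<Longrightarrow> cmod (f z) \<le> D"
  shows "hardy_mean f r \<le> D\<^sup>2"
proof -
  have "integral {0..2 * pi} (\<lambda>t. (cmod (f (rcis r t)))\<^sup>2) \<le> integral {0..2 * pi} (\<lambda>t. D\<^sup>2)"
    by (intro integral_le integrable_continuous_interval continuous_on_sq_rcis power_mono) (use assms in auto)
  then show ?thesis unfolding hardy_mean_def by (simp add: field_simps)
qed

lemma hardy_mean_mult_le:
  assumes "f holomorphic_on unit_disk" "g holomorphic_on unit_disk" "0 \<le> r" "r < 1"
    and "\<And>z. cmod z < 1 \<Longrightarrow> cmod (g z) \<le> B * cmod (f z)"
  shows "hardy_mean g r \<le> B\<^sup>2 * hardy_mean f r"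
proof -
  have "integral {0..2 * pi} (\<lambda>t. (cmod (g (rcis r t)))\<^sup>2) \<le> integral {0..2 * pi} (\<lambda>t. B\<^sup>2 * (cmod (f (rcis r t)))\<^sup>2)"
    using assms
    by (intro integral_le integrable_continuous_interval continuous_intros continuous_on_sq_rcis)
       (auto simp flip: power_mult_distrib intro!: power_mono)
  then show ?thesis unfolding hardy_mean_def by (simp add: field_simps)
qed

lemma hardy_mean_add_le:
  assumes "f holomorphic_on unit_disk" "g holomorphic_on unit_disk" "0 \<le> r" "r < 1"
  shows "hardy_mean (\<lambda>z. f z + g z) r \<le> 2 * hardy_mean f r + 2 * hardy_mean g r"
proof -
  have sq: "(cmod (a + b))\<^sup>2 \<le> 2 * (cmod a)\<^sup>2 + 2 * (cmod b)\<^sup>2" for a b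
  proof -
    have "(cmod (a + b))\<^sup>2 \<le> (cmod a + cmod b)\<^sup>2" by (intro power_mono norm_triangle_ineq) auto
    also have "\<dots> \<le> 2 * (cmod a)\<^sup>2 + 2 * (cmod b)\<^sup>2"
      using sum_squares_bound[of "cmod a" "cmod b"] by (simp add: power2_sum)
    finally show ?thesis .
  qed
  have "integral {0..2 * pi} (\<lambda>t. (cmod (f (rcis r t) + g (rcis r t)))\<^sup>2)
      \<le> integral {0..2 * pi} (\<lambda>t. 2 * (cmod (f (rcis r t)))\<^sup>2 + 2 * (cmod (g (rcis r t)))\<^sup>2)"
    using assms continuous_on_sq_rcis[of "\<lambda>z. f z + g z" r]
    by (intro integral_le integrable_continuous_interval continuous_intros continuous_on_sq_rcis sq)
       (auto intro: holomorphic_intros)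
  also have "\<dots> = 2 * integral {0..2 * pi} (\<lambda>t. (cmod (f (rcis r t)))\<^sup>2) + 2 * integral {0..2 * pi} (\<lambda>t. (cmod (g (rcis r t)))\<^sup>2)"
    using assms
    by (subst integral_add)
       (auto intro!: integrable_continuous_interval continuous_on_mult continuous_on_const continuous_on_sq_rcis)
  finally show ?thesis unfolding hardy_mean_def by (simp add: field_simps)
qed

lemma hardy2_holomorphic: "f \<in> hardy2 \<Longrightarrow> f holomorphic_on unit_disk"
  by (simp add: hardy2_def)

lemma hardy2_outside: "f \<in> hardy2 \<Longrightarrow> z \<notin> unit_disk \<Longrightarrow> f z = 0"
  by (simp add: hardy2_def)

lemma hardy_mean_le_norm:
  assumes "f \<in> hardy2" "0 \<le> r" "r < 1"
  shows "hardy_mean f r \<le> (hardy2_norm f)\<^sup>2"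
proof -
  have le: "hardy_mean f \<rho> \<le> (SUP r\<in>{0..<1}. hardy_mean f r)" if "0 \<le> \<rho>" "\<rho> < 1" for \<rho>
    using assms(1) that by (intro cSUP_upper) (auto simp: hardy2_def)
  have "0 \<le> (SUP r\<in>{0..<1}. hardy_mean f r)"
    using le[of 0] hardy_mean_nonneg[of f 0] by simp
  then show ?thesis using le[of r] assms by (simp add: hardy2_norm_def)
qed

lemma hardy2_norm_nonneg: "f \<in> hardy2 \<Longrightarrow> hardy2_norm f \<ge> 0"
  unfolding hardy2_norm_def
  using cSUP_upper[of 0 "{0..<1::real}" "hardy_mean f"] hardy_mean_nonneg[of f 0]
  by (simp add: hardy2_def)

lemma hardy2I:
  assumes "f holomorphic_on unit_disk" "\<And>z. z \<notin> unit_disk \<Longrightarrow> f z = 0"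
    and "\<And>r. 0 \<le> r \<Longrightarrow> r < 1 \<Longrightarrow> hardy_mean f r \<le> K\<^sup>2" "K \<ge> 0"
  shows "f \<in> hardy2" "hardy2_norm f \<le> K"
proof -
  show "f \<in> hardy2" using assms by (auto simp: hardy2_def intro!: bdd_aboveI[of _ "K\<^sup>2"])
  have "(SUP r\<in>{0..<1}. hardy_mean f r) \<le> K\<^sup>2" using assms by (intro cSUP_least) auto
  then show "hardy2_norm f \<le> K"
    unfolding hardy2_norm_def using \<open>K \<ge> 0\<close> by (intro real_le_lsqrt)
qed

lemma hardy2_bounded_function:
  assumes "f holomorphic_on unit_disk" "\<And>z. z \<notin> unit_disk \<Longrightarrow> f z = 0"
    and "\<And>z. cmod z < 1 \<Longrightarrow> cmod (f z) \<le> D"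
  shows "f \<in> hardy2" "hardy2_norm f \<le> D"
proof -
  have "0 \<le> D" using order_trans[OF norm_ge_zero assms(3)[of 0]] by simp
  then show "f \<in> hardy2" "hardy2_norm f \<le> D"
    using hardy2I[of f D] hardy_mean_le_const assms by blast+
qed

text \<open>The factor 2 avoids Minkowski's inequality; only boundedness of operators is at stake.\<close>

lemma hardy2_add:
  assumes f: "f \<in> hardy2" and g: "g \<in> hardy2"
  shows "(\<lambda>z. f z + g z) \<in> hardy2"
    and "hardy2_norm (\<lambda>z. f z + g z) \<le> 2 * (hardy2_norm f + hardy2_norm g)"
proof -
  note nn = hardy2_norm_nonneg[OF f] hardy2_norm_nonneg[OF g]
  have "hardy_mean (\<lambda>z. f z + g z) r \<le> (2 * (hardy2_norm f + hardy2_norm g))\<^sup>2" if "0 \<le> r" "r < 1" for r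
  proof -
    have "hardy_mean (\<lambda>z. f z + g z) r \<le> 2 * (hardy2_norm f)\<^sup>2 + 2 * (hardy2_norm g)\<^sup>2"
      using hardy_mean_add_le[OF hardy2_holomorphic[OF f] hardy2_holomorphic[OF g] that]
        hardy_mean_le_norm[OF f that] hardy_mean_le_norm[OF g that] by linarith
    also have "\<dots> \<le> 4 * (hardy2_norm f)\<^sup>2 + 4 * (hardy2_norm g)\<^sup>2 + 8 * (hardy2_norm f * hardy2_norm g)"
      using nn by simp
    also have "\<dots> = (2 * (hardy2_norm f + hardy2_norm g))\<^sup>2" by (simp add: power2_eq_square algebra_simps)
    finally show ?thesis .
  qed
  moreover have "(\<lambda>z. f z + g z) holomorphic_on unit_disk"
    using f g by (intro holomorphic_intros hardy2_holomorphic)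
  ultimately show "(\<lambda>z. f z + g z) \<in> hardy2"
    "hardy2_norm (\<lambda>z. f z + g z) \<le> 2 * (hardy2_norm f + hardy2_norm g)"
    using hardy2I[of "\<lambda>z. f z + g z" "2 * (hardy2_norm f + hardy2_norm g)"] nn hardy2_outside[OF f] hardy2_outside[OF g]
    by auto
qed

lemma hardy2_scale:
  assumes f: "f \<in> hardy2"
  shows "(\<lambda>z. c * f z) \<in> hardy2" "hardy2_norm (\<lambda>z. c * f z) \<le> cmod c * hardy2_norm f"
proof -
  have "hardy_mean (\<lambda>z. c * f z) r \<le> (cmod c * hardy2_norm f)\<^sup>2" if "0 \<le> r" "r < 1" for r
  proof -
    have "hardy_mean (\<lambda>z. c * f z) r \<le> (cmod c)\<^sup>2 * hardy_mean f r"
      using that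
      by (intro hardy_mean_mult_le holomorphic_intros hardy2_holomorphic[OF f]) (auto simp: norm_mult)
    also have "\<dots> \<le> (cmod c)\<^sup>2 * (hardy2_norm f)\<^sup>2"
      by (intro mult_left_mono hardy_mean_le_norm[OF f that]) auto
    finally show ?thesis by (simp add: power_mult_distrib)
  qed
  moreover have "(\<lambda>z. c * f z) holomorphic_on unit_disk"
    using f by (intro holomorphic_intros hardy2_holomorphic)
  ultimately show "(\<lambda>z. c * f z) \<in> hardy2" "hardy2_norm (\<lambda>z. c * f z) \<le> cmod c * hardy2_norm f"
    using hardy2I[of "\<lambda>z. c * f z" "cmod c * hardy2_norm f"] hardy2_norm_nonneg[OF f] hardy2_outside[OF f]
    by auto
qed

lemma hardy2_lincomb:
  assumes f: "f \<in> hardy2" and g: "g \<in> hardy2"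
  shows "(\<lambda>z. f z + c * g z) \<in> hardy2"
    and "hardy2_norm (\<lambda>z. f z + c * g z) \<le> 2 * (hardy2_norm f + cmod c * hardy2_norm g)"
proof -
  show "(\<lambda>z. f z + c * g z) \<in> hardy2" by (rule hardy2_add(1)[OF f hardy2_scale(1)[OF g]])
  show "hardy2_norm (\<lambda>z. f z + c * g z) \<le> 2 * (hardy2_norm f + cmod c * hardy2_norm g)"
    by (rule order_trans[OF hardy2_add(2)[OF f hardy2_scale(1)[OF g, of c]]])
       (use hardy2_scale(2)[OF g, of c] in simp)
qed

text \<open>The constant for the evaluation at \<open>z\<close> depends only on 1 - |z|, which stays
  above 1 - \<open>s\<close>. This turns norms into the pointwise estimates on which the iteration
  runs.\<close>

lemma hardy2_pointwise_bound:
  assumes s: "s < 1"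
  shows "\<exists>C\<ge>0. \<forall>f\<in>hardy2. \<forall>z. cmod z \<le> s \<longrightarrow> cmod (f z) \<le> C * hardy2_norm f"
proof (intro exI conjI ballI allI impI)
  show "0 \<le> sqrt (4 / (1 - s))" using s by simp
  fix f z assume f: "f \<in> hardy2" and z: "cmod z \<le> s"
  obtain R where R: "R \<in> {0..<1}" "(cmod (f z))\<^sup>2 \<le> 4 / (1 - cmod z) * hardy_mean f R"
    using cmod_sq_le_hardy_mean[OF hardy2_holomorphic[OF f], of z] z s by auto
  note R(2)
  also have "4 / (1 - cmod z) * hardy_mean f R \<le> 4 / (1 - s) * (hardy2_norm f)\<^sup>2"
    using R(1) z s by (intro mult_mono hardy_mean_le_norm[OF f] frac_le hardy_mean_nonneg) auto
  also have "\<dots> = (sqrt (4 / (1 - s)) * hardy2_norm f)\<^sup>2"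
    using s by (simp add: power_mult_distrib)
  finally show "cmod (f z) \<le> sqrt (4 / (1 - s)) * hardy2_norm f"
    by (rule power2_le_imp_le) (use s hardy2_norm_nonneg[OF f] in auto)
qed

section \<open>Boundedness of weighted composition operators\<close>

lemma weighted_comp_bounded:
  assumes u: "u holomorphic_on unit_disk" and B: "\<And>z. cmod z < 1 \<Longrightarrow> cmod (u z) \<le> B"
    and tau: "analytic_self_map \<tau>"
  shows "hardy2_bounded_op (weighted_comp u \<tau>)"
proof -
  \<comment> \<open>Subordination bounds the mean square, so the norm picks up the square root of
    its constant; the weight contributes \<open>B\<close>.\<close>
  define K where "K = B * sqrt (4 / (1 - cmod (\<tau> 0)))"
  have th: "\<tau> holomorphic_on unit_disk" and ti: "\<And>z. cmod z < 1 \<Longrightarrow> cmod (\<tau> z) < 1"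
    using tau by (auto simp: analytic_self_map_def image_subset_iff)
  have B0: "B \<ge> 0" using order_trans[OF norm_ge_zero B[of 0]] by simp
  have K0: "K \<ge> 0" using B0 ti[of 0] by (simp add: K_def)
  have main: "weighted_comp u \<tau> f \<in> hardy2 \<and> hardy2_norm (weighted_comp u \<tau> f) \<le> K * hardy2_norm f"
    if f: "f \<in> hardy2" for f
  proof -
    have fc: "(\<lambda>z. f (\<tau> z)) holomorphic_on unit_disk"
      using holomorphic_on_compose_gen[OF th hardy2_holomorphic[OF f]] ti by (auto simp: o_def image_subset_iff)
    have hol: "weighted_comp u \<tau> f holomorphic_on unit_disk"
      by (rule holomorphic_transform[of "\<lambda>z. u z * f (\<tau> z)"])
         (auto intro!: holomorphic_intros u fc simp: weighted_comp_def)
    have "hardy_mean (weighted_comp u \<tau> f) r \<le> (K * hardy2_norm f)\<^sup>2" if r: "0 \<le> r" "r < 1" for r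
    proof -
      have "hardy_mean (weighted_comp u \<tau> f) r \<le> B\<^sup>2 * hardy_mean (\<lambda>z. f (\<tau> z)) r"
        using B by (intro hardy_mean_mult_le fc hol r) (auto simp: weighted_comp_def norm_mult intro!: mult_right_mono)
      also have "hardy_mean (\<lambda>z. f (\<tau> z)) r \<le> 4 / (1 - cmod (\<tau> 0)) * (hardy2_norm f)\<^sup>2"
      proof -
        obtain R where R: "R \<in> {0..<1}" "hardy_mean (\<lambda>z. f (\<tau> z)) r \<le> 4 / (1 - cmod (\<tau> 0)) * hardy_mean f R"
          using hardy_mean_comp_le[OF hardy2_holomorphic[OF f] tau r] by auto
        note R(2)
        also have "4 / (1 - cmod (\<tau> 0)) * hardy_mean f R \<le> 4 / (1 - cmod (\<tau> 0)) * (hardy2_norm f)\<^sup>2"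
          using ti[of 0] R(1) by (intro mult_left_mono hardy_mean_le_norm[OF f]) auto
        finally show ?thesis .
      qed
      also have "B\<^sup>2 * (4 / (1 - cmod (\<tau> 0)) * (hardy2_norm f)\<^sup>2) = (K * hardy2_norm f)\<^sup>2"
        using ti[of 0] by (simp add: K_def power_mult_distrib)
      finally show ?thesis by (simp add: mult_left_mono)
    qed
    then show ?thesis
      using hardy2I[of "weighted_comp u \<tau> f" "K * hardy2_norm f"] hol K0 hardy2_norm_nonneg[OF f]
      by (auto simp: weighted_comp_def)
  qed
  then show ?thesis
    unfolding hardy2_bounded_op_def
    by (auto simp: weighted_comp_def algebra_simps fun_eq_iff intro!: exI[of _ K])
qed

lemma hardy2_bounded_op_shift:
  assumes T: "hardy2_bounded_op T"
  shows "hardy2_bounded_op (\<lambda>f z. T f z - \<mu> * f z)"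
proof -
  have mem: "\<And>f. f \<in> hardy2 \<Longrightarrow> T f \<in> hardy2"
    and add: "\<And>f g. f \<in> hardy2 \<Longrightarrow> g \<in> hardy2 \<Longrightarrow> T (\<lambda>z. f z + g z) = (\<lambda>z. T f z + T g z)"
    and scale: "\<And>f c. f \<in> hardy2 \<Longrightarrow> T (\<lambda>z. c * f z) = (\<lambda>z. c * T f z)"
    using T by (auto simp: hardy2_bounded_op_def)
  obtain K where K: "\<And>f. f \<in> hardy2 \<Longrightarrow> hardy2_norm (T f) \<le> K * hardy2_norm f"
    using T unfolding hardy2_bounded_op_def by blast
  have "(\<lambda>z. T f z - \<mu> * f z) \<in> hardy2 \<and>
        hardy2_norm (\<lambda>z. T f z - \<mu> * f z) \<le> (2 * K + 2 * cmod \<mu>) * hardy2_norm f"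
    if f: "f \<in> hardy2" for f
    using hardy2_lincomb[OF mem[OF f] f, of "- \<mu>"] K[OF f] by (simp add: algebra_simps)
  then show ?thesis unfolding hardy2_bounded_op_def
    by (auto simp: add scale algebra_simps fun_eq_iff intro!: exI[of _ "2 * K + 2 * cmod \<mu>"])
qed

section \<open>Division by powers of z - a\<close>

lemma holomorphic_div_zero:
  assumes "f holomorphic_on S" "open S" "f a = 0"
  obtains h where "h holomorphic_on S" "h a = deriv f a" "\<And>z. f z = (z - a) * h z"
proof
  show "(\<lambda>z. if z = a then deriv f a else (f z - f a) / (z - a)) holomorphic_on S"
    using assms by (intro pole_lemma_open)
qed (use assms in auto)

text \<open>Off \<open>a\<close> the power cancels, and continuity carries the equality to
  \<open>a\<close>. This permits comparing leading coefficients at \<open>a\<close>.\<close>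

lemma cancel_power_at:
  assumes "F holomorphic_on S" "G holomorphic_on S" "open S" "a \<in> S"
    and eq: "\<And>z. z \<in> S \<Longrightarrow> (z - a) ^ N * F z = (z - a) ^ N * (G z :: complex)"
  shows "F a = G a"
proof -
  have lim: "(F \<longlongrightarrow> F a) (at a)" "(G \<longlongrightarrow> G a) (at a)"
    using assms(1-4)
    by (auto simp: continuous_on_eq_continuous_at isCont_def dest!: holomorphic_on_imp_continuous_on)
  have "F z = G z" if "z \<in> S" "z \<noteq> a" for z
    using eq[OF that(1)] that(2) by simp
  then have "eventually (\<lambda>z. F z = G z) (at a)"
    unfolding eventually_at_topological using \<open>open S\<close> \<open>a \<in> S\<close> by blast
  from Lim_transform_eventually[OF lim(1) this] lim(2) show ?thesis
    by (rule LIM_unique)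
qed

text \<open>On a circle of radius \<open>s'\<close> beyond both \<open>s\<close> and |a| the divisor
  is at least \<open>s' - cmod a\<close> in modulus, so the quotient is controlled there; the
  maximum principle carries the bound inside, where the divisor may vanish.\<close>

lemma hardy2_quotient_bound:
  assumes s: "s < 1" and a: "cmod a < 1"
  shows "\<exists>C\<ge>0. \<forall>f\<in>hardy2. \<forall>G. G holomorphic_on unit_disk \<longrightarrow> (\<forall>z\<in>unit_disk. f z = (z - a) ^ N * G z)
    \<longrightarrow> (\<forall>z. cmod z \<le> s \<longrightarrow> cmod (G z) \<le> C * hardy2_norm f)"
proof -
  obtain s' where s': "max s (cmod a) < s'" "s' < 1"
    using dense[of "max s (cmod a)" 1] s a by auto
  obtain C where C: "C \<ge> 0" "\<And>f z. f \<in> hardy2 \<Longrightarrow> cmod z \<le> s' \<Longrightarrow> cmod (f z) \<le> C * hardy2_norm f"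
    using hardy2_pointwise_bound[OF s'(2)] by blast
  define d where "d = s' - cmod a"
  have d: "d > 0" using s' by (simp add: d_def)
  have "cmod (G z) \<le> C / d ^ N * hardy2_norm f"
    if f: "f \<in> hardy2" and G: "G holomorphic_on unit_disk"
      and eq: "\<forall>z\<in>unit_disk. f z = (z - a) ^ N * G z" and z: "cmod z \<le> s" for f G z
  proof (rule maximum_modulus_frontier[of G "cball 0 s'"])
    show "G holomorphic_on interior (cball 0 s')" "continuous_on (closure (cball 0 s')) G"
      using s' by (auto intro!: holomorphic_on_subset[OF G] continuous_on_subset[OF holomorphic_on_imp_continuous_on[OF G]])
    show "cmod (G y) \<le> C / d ^ N * hardy2_norm f" if "y \<in> frontier (cball 0 s')" for y
    proof -
      have y: "cmod y = s'" using that by (simp add: frontier_cball)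
      have "d \<le> cmod (y - a)" using norm_triangle_ineq2[of y a] y by (simp add: d_def)
      then have "d ^ N * cmod (G y) \<le> cmod (y - a) ^ N * cmod (G y)"
        using d by (intro mult_right_mono power_mono) auto
      also have "\<dots> = cmod (f y)" using eq y s' by (simp add: norm_mult norm_power)
      also have "\<dots> \<le> C * hardy2_norm f" using C(2)[OF f, of y] y by simp
      finally show ?thesis using d by (simp add: field_simps)
    qed
  qed (use z s' in auto)
  then show ?thesis using C(1) d by (intro exI[of _ "C / d ^ N"]) auto
qed

definition centered_power :: "complex \<Rightarrow> nat \<Rightarrow> complex \<Rightarrow> complex" where
  "centered_power a n z = (if z \<in> unit_disk then (z - a) ^ n else 0)"

lemma centered_power_hardy2: "centered_power a n \<in> hardy2"
proof (rule hardy2_bounded_function)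
  show "centered_power a n holomorphic_on unit_disk"
    by (rule holomorphic_transform[of "\<lambda>z. (z - a) ^ n"])
       (auto intro!: holomorphic_intros simp: centered_power_def)
  show "cmod (centered_power a n z) \<le> (1 + cmod a) ^ n" if "cmod z < 1" for z
    using that norm_triangle_ineq4[of z a]
    by (auto simp: centered_power_def norm_power intro!: power_mono)
qed (simp add: centered_power_def)

text \<open>The square of z ^ n has constant modulus on each circle, so the mean is exact. It is the
  lower bound against which the decay of order \<open>s ^ n\<close> is played in
  \<open>T_not_invertible\<close>.\<close>

lemma power_le_norm_centered_power:
  assumes "0 \<le> r" "r < 1"
  shows "r ^ n \<le> hardy2_norm (centered_power 0 n)"
proof -
  have "(cmod (centered_power 0 n (rcis r t)))\<^sup>2 = (r ^ n)\<^sup>2" for t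
    using assms by (simp add: centered_power_def norm_power)
  then have "hardy_mean (centered_power 0 n) r = integral {0..2 * pi} (\<lambda>t. (r ^ n)\<^sup>2) / (2 * pi)"
    unfolding hardy_mean_def by (simp only:)
  also have "\<dots> = (r ^ n)\<^sup>2" by simp
  finally have "(r ^ n)\<^sup>2 \<le> (hardy2_norm (centered_power 0 n))\<^sup>2"
    using hardy_mean_le_norm[OF centered_power_hardy2 assms, of 0 n] by (simp only:)
  then show ?thesis
    using hardy2_norm_nonneg[OF centered_power_hardy2] by (rule power2_le_imp_le)
qed

section \<open>Weighted composition operators with a contractive symbol\<close>

text \<open>The estimates concern the second iterate because the image of \<open>\<tau>\<close>
  itself may come arbitrarily close to the circle. Here \<open>s\<close> confines the image of the
  iterate and \<open>r\<close> is its contraction factor.\<close>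

locale contractive_weighted_comp =
  fixes u \<tau> :: "complex \<Rightarrow> complex" and w :: complex and B r s :: real
  assumes u_hol: "u holomorphic_on unit_disk"
    and u_bound: "\<And>z. cmod z < 1 \<Longrightarrow> cmod (u z) \<le> B"
    and self_map: "analytic_self_map \<tau>"
    and w: "cmod w < 1" and fix_w: "\<tau> w = w"
    and s: "s < 1" and iter_le: "\<And>z. cmod z < 1 \<Longrightarrow> cmod (\<tau> (\<tau> z)) \<le> s"
    and r: "0 < r" "r < 1"
    and contract: "\<And>z. cmod z < 1 \<Longrightarrow>
      cmod (Moebius_function 0 w (\<tau> (\<tau> z))) \<le> r * cmod (Moebius_function 0 w z)"
begin

abbreviation T where "T \<equiv> weighted_comp u \<tau>"
text \<open>The pseudo-hyperbolic distance from \<open>z\<close> to \<open>w\<close>.\<close>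

abbreviation \<rho> where "\<rho> z \<equiv> cmod (Moebius_function 0 w z)"

definition "\<Lambda> n = u w * deriv \<tau> w ^ n"

lemma tau_hol: "\<tau> holomorphic_on unit_disk" and tau_less: "cmod z < 1 \<Longrightarrow> cmod (\<tau> z) < 1"
  using self_map by (auto simp: analytic_self_map_def image_subset_iff)

lemma B_nonneg: "B \<ge> 0"
  using order_trans[OF norm_ge_zero u_bound[of 0]] by simp

lemma T_hardy2: "f \<in> hardy2 \<Longrightarrow> T f \<in> hardy2"
  using weighted_comp_bounded[OF u_hol u_bound self_map] by (simp add: hardy2_bounded_op_def)

lemma T_minus_hardy2: "f \<in> hardy2 \<Longrightarrow> (\<lambda>z. T f z - \<mu> * f z) \<in> hardy2"
  using hardy2_bounded_op_shift[OF weighted_comp_bounded[OF u_hol u_bound self_map]]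
  by (simp add: hardy2_bounded_op_def)

lemma tau_factor:
  obtains H where "H holomorphic_on unit_disk" "H w = deriv \<tau> w" "\<And>z. \<tau> z - w = (z - w) * H z"
proof -
  have "deriv (\<lambda>z. \<tau> z - w) w = deriv \<tau> w"
    using w tau_hol by (subst deriv_diff) (auto intro: holomorphic_on_imp_differentiable_at)
  moreover have "(\<lambda>z. \<tau> z - w) holomorphic_on unit_disk" by (intro holomorphic_intros tau_hol)
  moreover have "\<tau> w - w = 0" by (simp add: fix_w)
  ultimately show ?thesis
    using holomorphic_div_zero[of "\<lambda>z. \<tau> z - w" unit_disk w] that open_ball by metis
qed

lemma rho_eq: "\<rho> z = cmod (z - w) / cmod (1 - cnj w * z)"
  by (simp add: Moebius_function_simple norm_divide)

text \<open>The denominator in \<open>rho_eq\<close> is at most 2. Hence powers of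
  \<open>z - w\<close> can be measured by powers of \<open>\<rho> z\<close>, the quantity that the
  second iterate contracts.\<close>

lemma dist_le_rho: "cmod z < 1 \<Longrightarrow> cmod (z - w) \<le> 2 * \<rho> z"
proof -
  assume z: "cmod z < 1"
  have "cmod (cnj w * z) < 1" using norm_mult_less[of "cnj w" 1 z 1] w z by simp
  then have "cmod (1 - cnj w * z) > 0" "cmod (1 - cnj w * z) \<le> 2"
    using norm_triangle_ineq4[of 1 "cnj w * z"] by auto
  then show ?thesis
    using mult_left_mono[of "cmod (1 - cnj w * z)" 2 "cmod (z - w)"] by (simp add: rho_eq field_simps)
qed

lemma rho_le_1: "cmod z < 1 \<Longrightarrow> \<rho> z \<le> 1"
  using Moebius_function_norm_lt_1[OF w] by (simp add: less_imp_le)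

text \<open>Divide the contraction inequality by \<open>|z - w|\<close> and let \<open>z \<rightarrow> w\<close>; this gives \<open>|deriv \<tau> w|\<^sup>2 \<le> r\<close>.\<close>

lemma deriv_less_1: "cmod (deriv \<tau> w) < 1"
proof -
  obtain H where H: "H holomorphic_on unit_disk" "H w = deriv \<tau> w" "\<And>z. \<tau> z - w = (z - w) * H z"
    using tau_factor by blast
  define F where "F = (\<lambda>z. cmod (H (\<tau> z) * H z) * cmod (1 - cnj w * z))"
  define G where "G = (\<lambda>z. r * cmod (1 - cnj w * \<tau> (\<tau> z)))"
  have nz: "cmod (1 - cnj w * z) > 0" if "cmod z < 1" for z
    using norm_mult_less[of "cnj w" 1 z 1] w that by auto
  have le: "F z \<le> G z" if z: "cmod z < 1" "z \<noteq> w" for z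
  proof -
    have "\<tau> (\<tau> z) - w = (z - w) * (H (\<tau> z) * H z)"
      using H(3)[of z] H(3)[of "\<tau> z"] by simp
    then have "cmod (z - w) * cmod (H (\<tau> z) * H z) / cmod (1 - cnj w * \<tau> (\<tau> z))
       \<le> r * (cmod (z - w) / cmod (1 - cnj w * z))"
      using contract[OF z(1)] by (simp add: rho_eq norm_mult)
    then show ?thesis
      using nz[OF z(1)] nz[OF tau_less[OF tau_less[OF z(1)]]] z by (simp add: F_def G_def field_simps)
  qed
  have "continuous_on unit_disk (\<lambda>z. H (\<tau> z))"
    by (rule continuous_on_compose2[OF holomorphic_on_imp_continuous_on[OF H(1)] holomorphic_on_imp_continuous_on[OF tau_hol]])
       (use tau_less in auto)
  moreover have "continuous_on unit_disk (\<lambda>z. \<tau> (\<tau> z))"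
    by (rule continuous_on_compose2[OF holomorphic_on_imp_continuous_on[OF tau_hol] holomorphic_on_imp_continuous_on[OF tau_hol]])
       (use tau_less in auto)
  ultimately have "continuous_on unit_disk F" "continuous_on unit_disk G"
    unfolding F_def G_def by (auto intro!: continuous_intros holomorphic_on_imp_continuous_on[OF H(1)])
  then have lim: "(F \<longlongrightarrow> F w) (at w)" "(G \<longlongrightarrow> G w) (at w)"
    using w by (auto simp: continuous_on_eq_continuous_at isCont_def)
  have "eventually (\<lambda>z. F z \<le> G z) (at w)"
    using le w by (auto simp: eventually_at_topological intro!: exI[of _ unit_disk])
  then have "F w \<le> G w" using lim by (intro tendsto_le[of "at w" G _ F]) auto
  then have "cmod (deriv \<tau> w) ^ 2 \<le> r"
    using nz[OF w] by (simp add: F_def G_def fix_w H(2) norm_mult power2_eq_square)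
  then show ?thesis using r by (smt (verit) one_le_power)
qed

text \<open>Since \<open>\<tau> z - w\<close> is \<open>z - w\<close> times a function
  \<open>H\<close> with \<open>H w = deriv \<tau> w\<close>, composing with \<open>\<tau>\<close>
  reproduces the power of \<open>z - w\<close> and multiplies the cofactor by
  \<open>H z ^ N\<close>. The value at \<open>w\<close> shows that \<open>T - \<mu>\<close> acts
  triangularly with respect to the order at \<open>w\<close>.\<close>

lemma T_minus_factor:
  assumes f: "f \<in> hardy2" and G: "G holomorphic_on unit_disk"
    and eq: "\<And>z. z \<in> unit_disk \<Longrightarrow> f z = (z - w) ^ N * G z"
  obtains G' where "G' holomorphic_on unit_disk" "G' w = (\<Lambda> N - \<mu>) * G w"
    "\<And>z. z \<in> unit_disk \<Longrightarrow> T f z - \<mu> * f z = (z - w) ^ N * G' z"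
proof -
  obtain H where H: "H holomorphic_on unit_disk" "H w = deriv \<tau> w" "\<And>z. \<tau> z - w = (z - w) * H z"
    using tau_factor by blast
  have "(\<lambda>z. G (\<tau> z)) holomorphic_on unit_disk"
    using holomorphic_on_compose_gen[OF tau_hol G] tau_less by (auto simp: o_def image_subset_iff)
  then have "(\<lambda>z. u z * H z ^ N * G (\<tau> z) - \<mu> * G z) holomorphic_on unit_disk"
    by (intro holomorphic_intros u_hol H G)
  then show ?thesis
  proof (rule that)
    fix z assume z: "z \<in> unit_disk"
    then show "T f z - \<mu> * f z = (z - w) ^ N * (u z * H z ^ N * G (\<tau> z) - \<mu> * G z)"
    proof -
      have "f (\<tau> z) = (\<tau> z - w) ^ N * G (\<tau> z)" using eq[of "\<tau> z"] tau_less[of z] z by simp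
      then have "f (\<tau> z) = (z - w) ^ N * H z ^ N * G (\<tau> z)" by (simp only: H(3) power_mult_distrib)
      then show ?thesis using eq[OF z] z by (simp add: weighted_comp_def right_diff_distrib)
    qed
  qed (simp add: H(2) fix_w \<Lambda>_def algebra_simps)
qed

section \<open>Orders of vanishing at \<open>w\<close>\<close>

definition vanishes :: "nat \<Rightarrow> (complex \<Rightarrow> complex) \<Rightarrow> bool" where
  "vanishes N f \<longleftrightarrow> (\<exists>G. G holomorphic_on unit_disk \<and> (\<forall>z\<in>unit_disk. f z = (z - w) ^ N * G z))"

lemma vanishes_0: "f \<in> hardy2 \<Longrightarrow> vanishes 0 f"
  unfolding vanishes_def by (auto intro: hardy2_holomorphic)

lemma vanishes_Suc:
  assumes "G holomorphic_on unit_disk" "\<And>z. z \<in> unit_disk \<Longrightarrow> f z = (z - w) ^ N * G z" "G w = 0"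
  shows "vanishes (Suc N) f"
proof -
  obtain G2 where "G2 holomorphic_on unit_disk" "\<And>z. G z = (z - w) * G2 z"
    using holomorphic_div_zero[OF assms(1) open_ball assms(3)] by metis
  then show ?thesis using assms(2) unfolding vanishes_def by (auto intro!: exI[of _ G2])
qed

text \<open>The image has coefficient \<open>(\<Lambda> j - \<mu>) * G w\<close> at order
  \<open>j\<close>; if that coefficient is 0, so is \<open>G w\<close>, and \<open>f\<close> gains
  one order.\<close>

lemma vanishes_preimage:
  assumes f: "f \<in> hardy2" "vanishes j f" and nz: "\<Lambda> j \<noteq> \<mu>" and g: "vanishes (Suc j) (\<lambda>z. T f z - \<mu> * f z)"
  shows "vanishes (Suc j) f"
proof -
  obtain G where G: "G holomorphic_on unit_disk" "\<And>z. z \<in> unit_disk \<Longrightarrow> f z = (z - w) ^ j * G z"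
    using f by (auto simp: vanishes_def)
  obtain G' where G': "G' holomorphic_on unit_disk" "G' w = (\<Lambda> j - \<mu>) * G w"
    "\<And>z. z \<in> unit_disk \<Longrightarrow> T f z - \<mu> * f z = (z - w) ^ j * G' z"
    using T_minus_factor[OF f(1) G] by blast
  obtain K where K: "K holomorphic_on unit_disk" "\<And>z. z \<in> unit_disk \<Longrightarrow> T f z - \<mu> * f z = (z - w) ^ Suc j * K z"
    using g by (auto simp: vanishes_def)
  have "G' w = (\<lambda>z. (z - w) * K z) w"
  proof (rule cancel_power_at[where F = G' and G = "\<lambda>z. (z - w) * K z" and S = unit_disk and N = j])
    show "(z - w) ^ j * G' z = (z - w) ^ j * ((z - w) * K z)" if "z \<in> unit_disk" for z
      using G'(3)[OF that] K(2)[OF that] by (simp only: power_Suc2 mult.assoc)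
  qed (use w G' K in \<open>auto intro!: holomorphic_intros\<close>)
  then have "G w = 0" using G'(2) nz by simp
  then show ?thesis using vanishes_Suc[OF G] by blast
qed

section \<open>Decay of the powers of T composed with T\<close>

lemma TT_eq: "cmod z < 1 \<Longrightarrow> T (T f) z = u z * u (\<tau> z) * f (\<tau> (\<tau> z))"
  by (simp add: weighted_comp_def tau_less)

lemma T_outside: "\<not> cmod z < 1 \<Longrightarrow> T f z = 0"
  by (simp add: weighted_comp_def)

text \<open>Two weights give the square of \<open>B\<close>, and the contraction gives
  \<open>r ^ N\<close>. The second iterate lands in the disk of radius \<open>s\<close>, so a bound
  for \<open>f\<close> on that disk yields one for the image on the whole unit disk.\<close>

lemma TT_decay:
  assumes D: "\<And>z. cmod z \<le> s \<Longrightarrow> cmod (f z) \<le> D * \<rho> z ^ N" "D \<ge> 0" and z: "cmod z < 1"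
  shows "cmod (T (T f) z) \<le> D * (B\<^sup>2 * r ^ N) * \<rho> z ^ N"
proof -
  have "cmod (T (T f) z) = cmod (u z) * cmod (u (\<tau> z)) * cmod (f (\<tau> (\<tau> z)))"
    by (simp add: TT_eq[OF z] norm_mult)
  also have "\<dots> \<le> B * B * (D * \<rho> (\<tau> (\<tau> z)) ^ N)"
    using z by (intro mult_mono u_bound D iter_le tau_less) (auto simp: B_nonneg)
  also have "\<dots> \<le> B * B * (D * (r * \<rho> z) ^ N)"
    using z D(2) B_nonneg by (intro mult_left_mono power_mono contract) auto
  finally show ?thesis by (simp add: power_mult_distrib power2_eq_square mult_ac)
qed

text \<open>The exponent starts at 1 because the hypothesis controls \<open>f\<close> only on the
  disk of radius \<open>s\<close>; the first application extends the control to the unit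
  disk.\<close>

lemma TT_power_decay:
  assumes D: "\<And>z. cmod z \<le> s \<Longrightarrow> cmod (f z) \<le> D * \<rho> z ^ N" "D \<ge> 0" and z: "cmod z < 1"
  shows "cmod (((\<lambda>f. T (T f)) ^^ Suc m) f z) \<le> D * (B\<^sup>2 * r ^ N) ^ Suc m * \<rho> z ^ N"
  using z
proof (induction m arbitrary: z)
  case 0
  then show ?case using TT_decay[OF D] by simp
next
  case (Suc m)
  have "D * (B\<^sup>2 * r ^ N) ^ Suc m \<ge> 0" using D(2) r by simp
  then show ?case
    using TT_decay[OF Suc.IH _ Suc.prems] s by (simp add: mult_ac)
qed

text \<open>The cofactor is bounded by \<open>hardy2_quotient_bound\<close>, and replacing |z - w|
  by \<open>2 * \<rho> z\<close> costs the factor 2 ^ N.\<close>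

lemma vanishing_bound:
  "\<exists>C\<ge>0. \<forall>f\<in>hardy2. vanishes N f \<longrightarrow> (\<forall>z. cmod z \<le> s \<longrightarrow> cmod (f z) \<le> C * hardy2_norm f * \<rho> z ^ N)"
proof -
  obtain C where C: "C \<ge> 0" "\<And>f G z. f \<in> hardy2 \<Longrightarrow> G holomorphic_on unit_disk \<Longrightarrow>
      (\<forall>z\<in>unit_disk. f z = (z - w) ^ N * G z) \<Longrightarrow> cmod z \<le> s \<Longrightarrow> cmod (G z) \<le> C * hardy2_norm f"
    using hardy2_quotient_bound[OF s w, of N] by metis
  have "cmod (f z) \<le> 2 ^ N * C * hardy2_norm f * \<rho> z ^ N"
    if f: "f \<in> hardy2" "vanishes N f" and z: "cmod z \<le> s" for f z
  proof -
    obtain G where G: "G holomorphic_on unit_disk" "\<forall>z\<in>unit_disk. f z = (z - w) ^ N * G z"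
      using f by (auto simp: vanishes_def)
    have "cmod (f z) = cmod (z - w) ^ N * cmod (G z)"
      using G z s by (simp add: norm_mult norm_power)
    also have "\<dots> \<le> (2 * \<rho> z) ^ N * (C * hardy2_norm f)"
      using z s by (intro mult_mono power_mono dist_le_rho C(2)[OF f(1) G]) auto
    finally show ?thesis by (simp add: power_mult_distrib mult_ac)
  qed
  then show ?thesis using C(1) by (intro exI[of _ "2 ^ N * C"]) auto
qed

lemma ex_decay_exponent:
  assumes "\<epsilon> > 0"
  shows "\<exists>N. B\<^sup>2 * r ^ N \<le> \<epsilon>"
proof -
  have "(\<lambda>N. B\<^sup>2 * r ^ N) \<longlonglongrightarrow> B\<^sup>2 * 0" using r by (intro tendsto_intros) auto
  then have "eventually (\<lambda>N. B\<^sup>2 * r ^ N < \<epsilon>) sequentially" using assms by (intro order_tendstoD) auto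
  then show ?thesis by (meson eventually_sequentially less_imp_le order_refl)
qed

section \<open>Injectivity of \<open>T - \<mu>\<close>\<close>

lemma T_scale: "T (\<lambda>z. c * f z) = (\<lambda>z. c * T f z)"
  by (auto simp: weighted_comp_def)

text \<open>The image 0 vanishes to every order, so by \<open>vanishes_preimage\<close>
  \<open>f\<close> does too. For large \<open>N\<close> the equation
  \<open>T (T f) = \<mu> ^ 2 * f\<close> then halves any bound for \<open>f\<close> on the disk of
  radius \<open>s\<close>, which makes \<open>f\<close> zero there; the same equation spreads this
  to the unit disk.\<close>

lemma T_minus_injective:
  assumes f: "f \<in> hardy2" and eq: "\<And>z. T f z = \<mu> * f z" and \<mu>: "\<mu> \<noteq> 0" "\<And>n. \<Lambda> n \<noteq> \<mu>"
  shows "f z = 0"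
proof (cases "cmod z < 1")
  case z: True
  have van: "vanishes N f" for N
  proof (induction N)
    case (Suc N)
    moreover have "vanishes (Suc N) (\<lambda>z. T f z - \<mu> * f z)"
      unfolding vanishes_def by (intro exI[of _ "\<lambda>_. 0"]) (simp add: eq)
    ultimately show ?case by (intro vanishes_preimage[OF f _ \<mu>(2)])
  qed (rule vanishes_0[OF f])
  obtain N where N: "B\<^sup>2 * r ^ N \<le> (cmod \<mu>)\<^sup>2 / 2"
    using ex_decay_exponent[of "(cmod \<mu>)\<^sup>2 / 2"] \<mu>(1) by auto
  obtain D where D: "D \<ge> 0" "\<And>z. cmod z \<le> s \<Longrightarrow> cmod (f z) \<le> D * \<rho> z ^ N"
    using vanishing_bound[of N] f van[of N] hardy2_norm_nonneg[OF f] by (metis mult_nonneg_nonneg)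
  have "T f = (\<lambda>z. \<mu> * f z)" using eq by auto
  then have TT: "T (T f) z = \<mu> ^ 2 * f z" for z
    using T_scale[of \<mu> f] by (simp add: eq power2_eq_square)
  have bound: "\<forall>z. cmod z \<le> s \<longrightarrow> cmod (f z) \<le> D / 2 ^ m * \<rho> z ^ N" for m
  proof (induction m)
    case (Suc m)
    show ?case
    proof (intro allI impI)
      fix z assume "cmod z \<le> s"
      then have "(cmod \<mu>)\<^sup>2 * cmod (f z) \<le> D / 2 ^ m * (B\<^sup>2 * r ^ N) * \<rho> z ^ N"
        using TT_decay[of f "D / 2 ^ m" N z] Suc D(1) s by (simp add: TT norm_mult norm_power)
      also have "\<dots> \<le> D / 2 ^ m * ((cmod \<mu>)\<^sup>2 / 2) * \<rho> z ^ N"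
        using N D(1) by (intro mult_right_mono mult_left_mono) auto
      also have "\<dots> = (cmod \<mu>)\<^sup>2 * (D / 2 ^ Suc m * \<rho> z ^ N)" by (simp add: mult_ac)
      finally show "cmod (f z) \<le> D / 2 ^ Suc m * \<rho> z ^ N" 
        by (rule mult_left_le_imp_le) (use \<mu>(1) in simp)
    qed
  qed (use D in auto)
  have zero: "f y = 0" if "cmod y \<le> s" for y
  proof -
    have "(\<lambda>m. D * (1 / 2) ^ m * \<rho> y ^ N) \<longlonglongrightarrow> D * 0 * \<rho> y ^ N"
      by (intro tendsto_intros) auto
    then have "cmod (f y) \<le> D * 0 * \<rho> y ^ N"
      using bound that by (intro LIMSEQ_le_const[where X = "\<lambda>m. D * (1 / 2) ^ m * \<rho> y ^ N"]) (auto simp: power_divide)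
    then show ?thesis by simp
  qed
  have "\<mu> ^ 2 * f z = 0"
    using TT_eq[OF z, of f] zero[OF iter_le[OF z]] by (simp add: TT)
  then show ?thesis using \<mu>(1) by simp
qed (use hardy2_outside[OF f] in auto)

text \<open>The norm bound is part of the notion, so that an inverse obtained later by choosing
  solutions is bounded.\<close>

definition solvable :: "complex \<Rightarrow> nat \<Rightarrow> bool" where
  "solvable \<mu> N \<longleftrightarrow> (\<exists>K\<ge>0. \<forall>g\<in>hardy2. vanishes N g \<longrightarrow>
     (\<exists>f\<in>hardy2. (\<forall>z. T f z - \<mu> * f z = g z) \<and> hardy2_norm f \<le> K * hardy2_norm g))"

lemma T_minus_bound: "\<exists>K\<ge>0. \<forall>f\<in>hardy2. hardy2_norm (\<lambda>z. T f z - \<mu> * f z) \<le> K * hardy2_norm f"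
proof -
  obtain K where K: "\<forall>f\<in>hardy2. hardy2_norm (\<lambda>z. T f z - \<mu> * f z) \<le> K * hardy2_norm f"
    using hardy2_bounded_op_shift[OF weighted_comp_bounded[OF u_hol u_bound self_map], of \<mu>]
    unfolding hardy2_bounded_op_def by blast
  \<comment> \<open>The constant in \<open>hardy2_bounded_op\<close> has no prescribed sign; a
    nonnegative one can be multiplied into inequalities.\<close>
  have "K * hardy2_norm f \<le> max K 0 * hardy2_norm f" if "f \<in> hardy2" for f
    using hardy2_norm_nonneg[OF that] by (intro mult_right_mono) auto
  then show ?thesis using K by (intro exI[of _ "max K 0"]) force
qed

text \<open>The function \<open>h\<close> is the sum of \<open>\<nu> powi (-m) * (T\<^sup>2)\<^sup>m g\<close> over \<open>m \<ge> 1\<close>. After one application of \<open>T\<^sup>2\<close> only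
  values in the disk of radius \<open>s\<close> matter, so the series converges uniformly and completeness of the
  Hardy space is not needed.\<close>

lemma neumann_series:
  assumes N: "B\<^sup>2 * r ^ N \<le> (cmod \<nu>) / 2" and \<nu>: "\<nu> \<noteq> 0" and g: "g \<in> hardy2"
    and D: "D \<ge> 0" "\<And>z. cmod z \<le> s \<Longrightarrow> cmod (g z) \<le> D * \<rho> z ^ N"
  obtains h where "h \<in> hardy2" "hardy2_norm h \<le> D"
    "\<And>z. T (T h) z = \<nu> * h z - T (T g) z"
proof -
  define A where "A = (\<lambda>f. T (T f))"
  define a where "a = (\<lambda>m z. (A ^^ Suc m) g z / \<nu> ^ Suc m)"
  define h where "h = (\<lambda>z. \<Sum>m. a m z)"
  have mem: "(A ^^ m) g \<in> hardy2" for m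
    by (induction m) (auto simp: A_def g T_hardy2)
  have out: "a m z = 0" if "\<not> cmod z < 1" for m z
    using that by (simp add: a_def A_def T_outside)
  have le: "cmod (a m z) \<le> D * (1 / 2) ^ Suc m" if z: "cmod z < 1" for m z
  proof -
    have "cmod ((A ^^ Suc m) g z) \<le> D * (B\<^sup>2 * r ^ N) ^ Suc m * \<rho> z ^ N"
      unfolding A_def by (rule TT_power_decay[OF D(2,1) z])
    also have "\<dots> \<le> D * (cmod \<nu> / 2) ^ Suc m * 1"
      using N D(1) r rho_le_1[OF z] by (intro mult_mono mult_left_mono power_mono power_le_one) auto
    finally show ?thesis using \<nu> by (simp add: a_def norm_divide norm_power norm_mult field_simps)
  qed
  have geo: "(\<lambda>m. D * (1 / 2) ^ Suc m) sums D"
    using sums_mult[OF power_half_series, of D] by simp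
  have sum_a: "summable (\<lambda>m. a m z)" if "cmod z < 1" for z
    by (rule summable_comparison_test'[OF sums_summable[OF geo]]) (use le[OF that] in auto)
  have lim: "uniform_limit unit_disk (\<lambda>n z. \<Sum>i<n. a i z) h sequentially"
    unfolding h_def by (rule Weierstrass_m_test[OF _ sums_summable[OF geo]]) (use le in auto)
  have hol: "h holomorphic_on unit_disk"
  proof (rule holomorphic_uniform_sequence[OF open_ball])
    show "(\<lambda>z. \<Sum>i<n. a i z) holomorphic_on unit_disk" for n
      unfolding a_def by (intro holomorphic_intros hardy2_holomorphic mem) (use \<nu> in auto)
    fix x :: complex assume "x \<in> unit_disk"
    then obtain d where "d > 0" "cball x d \<subseteq> unit_disk" using open_contains_cball by blast
    then show "\<exists>d. 0 < d \<and> cball x d \<subseteq> unit_disk \<and> uniform_limit (cball x d) (\<lambda>n z. \<Sum>i<n. a i z) h sequentially"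
      using uniform_limit_on_subset[OF lim] by blast
  qed
  have hle: "cmod (h z) \<le> D" if "cmod z < 1" for z
  proof -
    have "cmod (h z) \<le> (\<Sum>m. D * (1 / 2) ^ Suc m)"
      unfolding h_def by (rule norm_suminf_le[OF le[OF that] sums_summable[OF geo]])
    then show ?thesis using sums_unique[OF geo] by simp
  qed
  have hout: "h z = 0" if "z \<notin> unit_disk" for z
    using that out[of z] by (simp add: h_def)
  have "T (T h) z = \<nu> * h z - T (T g) z" for z
  proof (cases "cmod z < 1")
    case z: True
    \<comment> \<open>Applying \<open>T\<close> twice moves each summand to the next one, up to the
      factor \<open>\<nu>\<close>.\<close>
    have shift: "u z * u (\<tau> z) * a m (\<tau> (\<tau> z)) = \<nu> * a (Suc m) z" for m
      using TT_eq[OF z, of "(A ^^ Suc m) g"] \<nu> by (simp add: a_def A_def)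
    have "T (T h) z = u z * u (\<tau> z) * (\<Sum>m. a m (\<tau> (\<tau> z)))"
      by (simp add: TT_eq[OF z] h_def)
    also have "\<dots> = (\<Sum>m. u z * u (\<tau> z) * a m (\<tau> (\<tau> z)))"
      by (rule suminf_mult[OF sum_a, symmetric]) (intro tau_less z)
    also have "\<dots> = (\<Sum>m. \<nu> * a (Suc m) z)" by (simp only: shift)
    also have "\<dots> = \<nu> * (\<Sum>m. a (Suc m) z)"
      using summable_ignore_initial_segment[OF sum_a[OF z], of 1] by (intro suminf_mult) simp
    \<comment> \<open>The shifted series lacks the first term, and \<open>\<nu> * a 0 z\<close> is
      the correction \<open>T (T g) z\<close>.\<close>
    also have "(\<Sum>m. a (Suc m) z) = h z - a 0 z"
      unfolding h_def by (rule suminf_split_head[OF sum_a[OF z]])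
    finally show ?thesis using \<nu> by (simp add: a_def A_def algebra_simps)
  next
    case False
    then show ?thesis using hout[of z] by (simp add: T_outside)
  qed
  then show ?thesis
    using hardy2_bounded_function[OF hol hout hle] that by blast
qed

text \<open>If \<open>k\<close> solves \<open>T\<^sup>2 k - \<mu>\<^sup>2 k = g\<close>, then \<open>T k + \<mu> k\<close> solves \<open>T f - \<mu> f = g\<close>.\<close>

lemma solvable_large:
  assumes \<mu>: "\<mu> \<noteq> 0" and N: "B\<^sup>2 * r ^ N \<le> (cmod \<mu>)\<^sup>2 / 2"
  shows "solvable \<mu> N"
proof -
  obtain C where C: "C \<ge> 0" "\<And>g z. g \<in> hardy2 \<Longrightarrow> vanishes N g \<Longrightarrow> cmod z \<le> s \<Longrightarrow>
      cmod (g z) \<le> C * hardy2_norm g * \<rho> z ^ N"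
    using vanishing_bound[of N] by blast
  obtain K where K: "K \<ge> 0" "\<And>f. f \<in> hardy2 \<Longrightarrow> hardy2_norm (\<lambda>z. T f z - (- \<mu>) * f z) \<le> K * hardy2_norm f"
    using T_minus_bound[of "- \<mu>"] by blast
  define M where "M = K * (cmod (- 1 / \<mu>\<^sup>2) * (2 * (1 + C)))"
  have "\<exists>f\<in>hardy2. (\<forall>z. T f z - \<mu> * f z = g z) \<and> hardy2_norm f \<le> M * hardy2_norm g"
    if g: "g \<in> hardy2" "vanishes N g" for g
  proof -
    have D: "C * hardy2_norm g \<ge> 0" using C(1) hardy2_norm_nonneg[OF g(1)] by simp
    have N': "B\<^sup>2 * r ^ N \<le> cmod (\<mu>\<^sup>2) / 2" using N by (simp add: norm_power)
    obtain h where h: "h \<in> hardy2" "hardy2_norm h \<le> C * hardy2_norm g"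
      "\<And>z. T (T h) z = \<mu>\<^sup>2 * h z - T (T g) z"
      using neumann_series[OF N' _ g(1) D C(2)[OF g]] \<mu> by auto
    \<comment> \<open>The complete Neumann series for the inverse of
      \<open>T\<^sup>2 - \<mu>\<^sup>2\<close> at \<open>g\<close>: \<open>g\<close> is its term of
      index 0 and \<open>h\<close> collects the others.\<close>
    define k where "k = (\<lambda>z. (- 1 / \<mu>\<^sup>2) * (g z + h z))"
    have k: "k \<in> hardy2" unfolding k_def by (intro hardy2_scale hardy2_add g h)
    have "hardy2_norm k \<le> cmod (- 1 / \<mu>\<^sup>2) * hardy2_norm (\<lambda>z. g z + h z)"
      unfolding k_def by (intro hardy2_scale(2) hardy2_add(1) g h)
    also have "\<dots> \<le> cmod (- 1 / \<mu>\<^sup>2) * (2 * (hardy2_norm g + C * hardy2_norm g))"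
      using hardy2_add(2)[OF g(1) h(1)] h(2) by (intro mult_left_mono) auto
    finally have kn: "hardy2_norm k \<le> cmod (- 1 / \<mu>\<^sup>2) * (2 * (1 + C)) * hardy2_norm g"
      by (simp add: algebra_simps)
    \<comment> \<open>\<open>T k + \<mu> k\<close>, written as \<open>T\<close> minus a scalar so
      that the bound \<open>K\<close> applies.\<close>
    define f where "f = (\<lambda>z. T k z - (- \<mu>) * k z)"
    have "f \<in> hardy2" unfolding f_def by (rule T_minus_hardy2[OF k])
    moreover have "hardy2_norm f \<le> M * hardy2_norm g"
      using K(2)[OF k] mult_left_mono[OF kn K(1)] by (simp add: f_def M_def mult_ac)
    moreover have "T f z - \<mu> * f z = g z" for z
    proof (cases "cmod z < 1")
      case z: True
      have "T (T k) z = (- 1 / \<mu>\<^sup>2) * (T (T g) z + T (T h) z)"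
        unfolding TT_eq[OF z] k_def by (simp add: algebra_simps)
      also have "\<dots> = - h z" using h(3)[of z] \<mu> by simp
      finally have "T (T k) z = - h z" .
      have Tf: "T f z = T (T k) z + \<mu> * T k z"
        using z by (simp add: weighted_comp_def f_def algebra_simps)
      have "T f z - \<mu> * f z = T (T k) z - \<mu>\<^sup>2 * k z"
        unfolding Tf by (simp add: f_def algebra_simps power2_eq_square)
      also have "\<mu>\<^sup>2 * k z = - (g z + h z)" using \<mu> by (simp add: k_def)
      finally show ?thesis using \<open>T (T k) z = - h z\<close> by simp
    next
      case False
      then show ?thesis using hardy2_outside[OF g(1)] hardy2_outside[OF h(1)]
        by (simp add: T_outside f_def k_def)
    qed
    ultimately show ?thesis by blast
  qed
  moreover have "M \<ge> 0" using K(1) C(1) by (simp add: M_def)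
  ultimately show ?thesis unfolding solvable_def by blast
qed

text \<open>A multiple of the image of \<open>(z - w) ^ N\<close> cancels the leading coefficient of
  \<open>g\<close>; the rest vanishes to order \<open>Suc N\<close> and is solved by hypothesis. The
  multiple of \<open>(z - w) ^ N\<close> is then added back to the solution.\<close>

lemma solvable_step:
  assumes \<Lambda>: "\<Lambda> N \<noteq> \<mu>" and IH: "solvable \<mu> (Suc N)"
  shows "solvable \<mu> N"
proof -
  \<comment> \<open>Only the value of the cofactor at \<open>w\<close> is wanted, so the radius |w|
    suffices.\<close>
  obtain C where C: "C \<ge> 0" "\<And>g G z. g \<in> hardy2 \<Longrightarrow> G holomorphic_on unit_disk \<Longrightarrow>
      (\<forall>z\<in>unit_disk. g z = (z - w) ^ N * G z) \<Longrightarrow> cmod z \<le> cmod w \<Longrightarrow> cmod (G z) \<le> C * hardy2_norm g"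
    using hardy2_quotient_bound[OF w w, of N] by metis
  obtain K where K: "K \<ge> 0" "\<And>g. g \<in> hardy2 \<Longrightarrow> vanishes (Suc N) g \<Longrightarrow>
     (\<exists>f\<in>hardy2. (\<forall>z. T f z - \<mu> * f z = g z) \<and> hardy2_norm f \<le> K * hardy2_norm g)"
    using IH unfolding solvable_def by blast
  define e where "e = centered_power w N"
  have e: "e \<in> hardy2" unfolding e_def by (rule centered_power_hardy2)
  define e' where "e' = (\<lambda>z. T e z - \<mu> * e z)"
  have e': "e' \<in> hardy2" unfolding e'_def by (rule T_minus_hardy2[OF e])
  obtain E where E: "E holomorphic_on unit_disk" "E w = (\<Lambda> N - \<mu>) * 1"
    "\<And>z. z \<in> unit_disk \<Longrightarrow> T e z - \<mu> * e z = (z - w) ^ N * E z"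
    using T_minus_factor[OF e, of "\<lambda>_. 1" N] by (auto simp: e_def centered_power_def)
  define c' where "c' = C / cmod (\<Lambda> N - \<mu>)"
  have c'0: "c' \<ge> 0" using C(1) by (simp add: c'_def)
  note nn = hardy2_norm_nonneg[OF e] hardy2_norm_nonneg[OF e']
  define M where "M = 2 * (K * (2 * (1 + c' * hardy2_norm e')) + c' * hardy2_norm e)"
  have "\<exists>f\<in>hardy2. (\<forall>z. T f z - \<mu> * f z = g z) \<and> hardy2_norm f \<le> M * hardy2_norm g"
    if g: "g \<in> hardy2" "vanishes N g" for g
  proof -
    obtain G where G: "G holomorphic_on unit_disk" "\<forall>z\<in>unit_disk. g z = (z - w) ^ N * G z"
      using g by (auto simp: vanishes_def)
    define c where "c = G w / (\<Lambda> N - \<mu>)"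
    have "cmod c \<le> C * hardy2_norm g / cmod (\<Lambda> N - \<mu>)"
      unfolding c_def norm_divide by (intro divide_right_mono C(2)[OF g(1) G]) auto
    then have c: "cmod c \<le> c' * hardy2_norm g" by (simp add: c'_def)
    define g2 where "g2 = (\<lambda>z. g z + (- c) * e' z)"
    have g2: "g2 \<in> hardy2" unfolding g2_def by (rule hardy2_lincomb[OF g(1) e'])
    have "vanishes (Suc N) g2"
    proof (rule vanishes_Suc)
      show "(\<lambda>z. G z + (- c) * E z) holomorphic_on unit_disk" by (intro holomorphic_intros G E)
      show "g2 z = (z - w) ^ N * (G z + - c * E z)" if "z \<in> unit_disk" for z
        using G(2) E(3)[OF that] that by (simp add: g2_def e'_def algebra_simps)
      show "G w + - c * E w = 0" using \<Lambda> E(2) by (simp add: c_def)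
    qed
    then obtain f2 where f2: "f2 \<in> hardy2" "\<And>z. T f2 z - \<mu> * f2 z = g2 z"
      "hardy2_norm f2 \<le> K * hardy2_norm g2"
      using K(2)[OF g2] by blast
    define f where "f = (\<lambda>z. f2 z + c * e z)"
    have "f \<in> hardy2" unfolding f_def by (rule hardy2_lincomb[OF f2(1) e])
    moreover have "T f z - \<mu> * f z = g z" for z
    proof -
      have "T f z = T f2 z + c * T e z" by (simp add: f_def weighted_comp_def algebra_simps)
      then show ?thesis using f2(2)[of z] by (simp add: f_def g2_def e'_def algebra_simps)
    qed
    moreover have "hardy2_norm f \<le> M * hardy2_norm g"
    proof -
      have "hardy2_norm g2 \<le> 2 * (hardy2_norm g + cmod (- c) * hardy2_norm e')"
        unfolding g2_def by (rule hardy2_lincomb(2)[OF g(1) e'])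
      also have "\<dots> \<le> 2 * (hardy2_norm g + c' * hardy2_norm g * hardy2_norm e')"
        using mult_right_mono[OF c nn(2)] by simp
      finally have "K * hardy2_norm g2 \<le> K * (2 * (hardy2_norm g + c' * hardy2_norm g * hardy2_norm e'))"
        using K(1) by (rule mult_left_mono)
      then have f2n: "hardy2_norm f2 \<le> K * (2 * (hardy2_norm g + c' * hardy2_norm g * hardy2_norm e'))"
        using f2(3) by (rule order_trans[rotated])
      have "hardy2_norm f \<le> 2 * (hardy2_norm f2 + cmod c * hardy2_norm e)"
        unfolding f_def by (rule hardy2_lincomb(2)[OF f2(1) e])
      also have "\<dots> \<le> 2 * (K * (2 * (hardy2_norm g + c' * hardy2_norm g * hardy2_norm e')) +
          c' * hardy2_norm g * hardy2_norm e)"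
        by (intro mult_left_mono add_mono f2n mult_right_mono c nn) auto
      also have "\<dots> = M * hardy2_norm g" by (simp add: M_def algebra_simps)
      finally show ?thesis .
    qed
    ultimately show ?thesis by blast
  qed
  moreover have "M \<ge> 0" using K(1) c'0 nn by (simp add: M_def)
  ultimately show ?thesis unfolding solvable_def by blast
qed

text \<open>Solvability holds for some large order and descends to order 0, where vanishing is no
  restriction. Choosing solutions gives the inverse.\<close>

lemma T_minus_invertible:
  assumes \<mu>: "\<mu> \<noteq> 0" "\<And>n. \<Lambda> n \<noteq> \<mu>"
  shows "hardy2_invertible_op (\<lambda>f z. T f z - \<mu> * f z)"
proof -
  obtain N where "B\<^sup>2 * r ^ N \<le> (cmod \<mu>)\<^sup>2 / 2"
    using ex_decay_exponent[of "(cmod \<mu>)\<^sup>2 / 2"] \<mu>(1) by auto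
  then have "solvable \<mu> N" by (rule solvable_large[OF \<mu>(1)])
  then have "solvable \<mu> 0" by (induction N) (auto intro: solvable_step[OF \<mu>(2)])
  then obtain K where K: "\<And>g. g \<in> hardy2 \<Longrightarrow>
     (\<exists>f\<in>hardy2. (\<forall>z. T f z - \<mu> * f z = g z) \<and> hardy2_norm f \<le> K * hardy2_norm g)"
    unfolding solvable_def using vanishes_0 by blast
  then obtain S where S: "\<And>g. g \<in> hardy2 \<Longrightarrow> S g \<in> hardy2"
    "\<And>g z. g \<in> hardy2 \<Longrightarrow> T (S g) z - \<mu> * S g z = g z"
    "\<And>g. g \<in> hardy2 \<Longrightarrow> hardy2_norm (S g) \<le> K * hardy2_norm g"
    by metis
  \<comment> \<open>Injectivity makes the chosen \<open>S\<close> linear: both sides of each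
    linearity law solve the same equation.\<close>
  have uniq: "f = g" if "f \<in> hardy2" "g \<in> hardy2" "\<And>z. T f z - \<mu> * f z = T g z - \<mu> * g z" for f g
  proof
    fix z
    have "f z + (- 1) * g z = 0"
    proof (rule T_minus_injective[OF hardy2_lincomb(1)[OF that(1,2)] _ \<mu>])
      fix z
      show "T (\<lambda>z. f z + (- 1) * g z) z = \<mu> * (f z + (- 1) * g z)"
        using that(3)[of z] by (simp add: weighted_comp_def algebra_simps split: if_splits)
    qed
    then show "f z = g z" by simp
  qed
  have "hardy2_bounded_op S"
    unfolding hardy2_bounded_op_def
  proof (intro conjI ballI allI)
    fix f g c assume f: "f \<in> hardy2" and g: "g \<in> hardy2"
    show "S (\<lambda>z. f z + g z) = (\<lambda>z. S f z + S g z)"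
    proof (rule uniq)
      fix z
      have "T (\<lambda>z. S f z + S g z) z = T (S f) z + T (S g) z" by (simp add: weighted_comp_def algebra_simps)
      then show "T (S (\<lambda>z. f z + g z)) z - \<mu> * S (\<lambda>z. f z + g z) z =
          T (\<lambda>z. S f z + S g z) z - \<mu> * (S f z + S g z)"
        using S(2)[OF f, of z] S(2)[OF g, of z] S(2)[OF hardy2_add(1)[OF f g], of z] by (simp add: algebra_simps)
    qed (intro S hardy2_add f g)+
  next
    fix f c assume f: "f \<in> hardy2"
    show "S (\<lambda>z. c * f z) = (\<lambda>z. c * S f z)"
    proof (rule uniq)
      fix z
      have "c * T (S f) z - c * (\<mu> * S f z) = c * f z"
        using S(2)[OF f, of z] by (simp flip: right_diff_distrib)
      then show "T (S (\<lambda>z. c * f z)) z - \<mu> * S (\<lambda>z. c * f z) z = T (\<lambda>z. c * S f z) z - \<mu> * (c * S f z)"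
        using S(2)[OF hardy2_scale(1)[OF f, of c], of z] by (simp add: T_scale mult_ac)
    qed (intro S hardy2_scale f)+
  next
    show "\<exists>K. \<forall>f\<in>hardy2. hardy2_norm (S f) \<le> K * hardy2_norm f" using S(3) by blast
  qed (use S in auto)
  moreover have "S (\<lambda>z. T f z - \<mu> * f z) = f" if "f \<in> hardy2" for f
    by (rule uniq) (use S T_minus_hardy2 that in auto)
  ultimately show ?thesis
    unfolding hardy2_invertible_op_def
    using hardy2_bounded_op_shift[OF weighted_comp_bounded[OF u_hol u_bound self_map]] S
    by (intro conjI exI[of _ S]) auto
qed

text \<open>A bounded inverse would bound the norm of \<open>z ^ n\<close> by a multiple of that of \<open>T\<^sup>2 (z ^ n)\<close>, which is \<open>O(s ^ n)\<close>.\<close>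

lemma T_not_invertible: "\<not> hardy2_invertible_op T"
proof
  assume "hardy2_invertible_op T"
  then obtain S where op: "hardy2_bounded_op S" and S: "\<And>f. f \<in> hardy2 \<Longrightarrow> S (T f) = f"
    unfolding hardy2_invertible_op_def by blast
  have mem: "\<And>f. f \<in> hardy2 \<Longrightarrow> S f \<in> hardy2"
    using op unfolding hardy2_bounded_op_def by blast
  obtain K where K: "\<And>f. f \<in> hardy2 \<Longrightarrow> hardy2_norm (S f) \<le> K * hardy2_norm f"
    using op unfolding hardy2_bounded_op_def by blast
  define K' where "K' = max K 0"
  have K': "hardy2_norm (S f) \<le> K' * hardy2_norm f" if "f \<in> hardy2" for f
    by (rule order_trans[OF K[OF that] mult_right_mono[OF _ hardy2_norm_nonneg[OF that]]])
       (simp add: K'_def)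
  have s0: "s \<ge> 0" using order_trans[OF norm_ge_zero iter_le[of 0]] by simp
  \<comment> \<open>A radius strictly above \<open>s\<close>, so that the powers of
    \<open>s / t\<close> tend to 0.\<close>
  obtain t where t: "s < t" "t < 1" using dense s by blast
  let ?e = "centered_power 0"
  have le: "t ^ n \<le> K' * (K' * (B * B * s ^ n))" for n
  proof -
    have e: "?e n \<in> hardy2" by (rule centered_power_hardy2)
    have TT: "hardy2_norm (T (T (?e n))) \<le> B * B * s ^ n"
    proof (rule hardy2_bounded_function)
      fix z :: complex assume z: "cmod z < 1"
      have "cmod (u z) * cmod (u (\<tau> z)) * cmod (\<tau> (\<tau> z)) ^ n \<le> B * B * s ^ n"
        using z B_nonneg by (intro mult_mono power_mono u_bound tau_less iter_le) auto
      then show "cmod (T (T (?e n)) z) \<le> B * B * s ^ n"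
        using tau_less[OF tau_less[OF z]] by (simp add: TT_eq[OF z] centered_power_def norm_mult norm_power)
    qed (auto intro!: hardy2_holomorphic T_hardy2 e simp: T_outside)
    have "t ^ n \<le> hardy2_norm (?e n)"
      using t s0 by (intro power_le_norm_centered_power) auto
    also have "\<dots> = hardy2_norm (S (S (T (T (?e n)))))" using S e T_hardy2 by simp
    also have "\<dots> \<le> K' * hardy2_norm (S (T (T (?e n))))" by (intro K' mem T_hardy2 e)
    also have "\<dots> \<le> K' * (K' * hardy2_norm (T (T (?e n))))"
      by (intro mult_left_mono K' T_hardy2 e) (simp add: K'_def)
    also have "\<dots> \<le> K' * (K' * (B * B * s ^ n))"
      by (intro mult_left_mono TT) (simp_all add: K'_def)
    finally show ?thesis .
  qed
  have "(\<lambda>n. K' * (K' * (B * B * (s / t) ^ n))) \<longlonglongrightarrow> K' * (K' * (B * B * 0))"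
    using t s0 by (intro tendsto_intros LIMSEQ_power_zero) auto
  moreover have "1 \<le> K' * (K' * (B * B * (s / t) ^ n))" for n
    using le[of n] t s0 by (simp add: power_divide field_simps)
  ultimately have "1 \<le> K' * (K' * (B * B * 0))" by (intro LIMSEQ_le_const) auto
  then show False by simp
qed

text \<open>The equation \<open>T f - \<Lambda> n f = (z - w) ^ n\<close> has no solution: comparing lowest order terms at \<open>w\<close> forces
  \<open>f\<close> to vanish to order \<open>n\<close>, and then the coefficient of \<open>(z - w) ^ n\<close> on the left is 0.\<close>

lemma T_minus_eigenvalue_not_invertible:
  assumes nz: "\<Lambda> n \<noteq> 0"
  shows "\<not> hardy2_invertible_op (\<lambda>f z. T f z - \<Lambda> n * f z)"
proof
  assume "hardy2_invertible_op (\<lambda>f z. T f z - \<Lambda> n * f z)"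
  then obtain S where "hardy2_bounded_op S" "\<forall>f\<in>hardy2. (\<lambda>z. T (S f) z - \<Lambda> n * S f z) = f"
    unfolding hardy2_invertible_op_def by blast
  then obtain f where f: "f \<in> hardy2" "(\<lambda>z. T f z - \<Lambda> n * f z) = centered_power w n"
    using centered_power_hardy2 unfolding hardy2_bounded_op_def by blast
  have van: "vanishes j f" if "j \<le> n" for j
    using that
  proof (induction j)
    case (Suc j)
    \<comment> \<open>The moduli of \<open>\<Lambda>\<close> decrease strictly when the derivative
      is nonzero. A zero derivative would make \<open>\<Lambda> n\<close> zero, since
      \<open>n\<close> is positive here.\<close>
    have "\<Lambda> j \<noteq> \<Lambda> n"
    proof
      assume eq: "\<Lambda> j = \<Lambda> n"
      have u: "u w \<noteq> 0" using nz by (auto simp: \<Lambda>_def)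
      show False
      proof (cases "deriv \<tau> w = 0")
        case True
        then show ?thesis using nz Suc.prems by (simp add: \<Lambda>_def)
      next
        case False
        have "cmod (deriv \<tau> w) ^ j = cmod (deriv \<tau> w) ^ n"
          using eq u by (simp add: \<Lambda>_def flip: norm_power)
        moreover have "cmod (deriv \<tau> w) ^ n < cmod (deriv \<tau> w) ^ j"
          using Suc.prems deriv_less_1 False by (intro power_strict_decreasing) auto
        ultimately show False by simp
      qed
    qed
    moreover have "vanishes (Suc j) (\<lambda>z. T f z - \<Lambda> n * f z)"
      unfolding f(2) vanishes_def
    proof (intro exI[of _ "\<lambda>z. (z - w) ^ (n - Suc j)"] conjI ballI)
      fix z assume "z \<in> unit_disk"
      then show "centered_power w n z = (z - w) ^ Suc j * (z - w) ^ (n - Suc j)"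
        using Suc.prems by (simp add: centered_power_def flip: power_add power_Suc)
    qed (intro holomorphic_intros)
    ultimately show ?case using Suc by (intro vanishes_preimage[OF f(1)]) auto
  qed (rule vanishes_0[OF f(1)])
  obtain G where G: "G holomorphic_on unit_disk" "\<And>z. z \<in> unit_disk \<Longrightarrow> f z = (z - w) ^ n * G z"
    using van[of n] by (auto simp: vanishes_def)
  obtain G' where G': "G' holomorphic_on unit_disk" "G' w = (\<Lambda> n - \<Lambda> n) * G w"
    "\<And>z. z \<in> unit_disk \<Longrightarrow> T f z - \<Lambda> n * f z = (z - w) ^ n * G' z"
    using T_minus_factor[OF f(1) G] by blast
  have "G' w = 1"
  proof (rule cancel_power_at[where F = G' and G = "\<lambda>_. 1" and S = unit_disk and N = n])
    show "(z - w) ^ n * G' z = (z - w) ^ n * 1" if "z \<in> unit_disk" for z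
      using G'(3)[OF that] fun_cong[OF f(2), of z] that by (simp add: centered_power_def)
  qed (use w G' in auto)
  then show False using G'(2) by simp
qed

section \<open>The spectrum and the spectral radius\<close>

theorem spectrum: "hardy2_spectrum T = insert 0 (range \<Lambda>)"
proof (intro set_eqI iffI)
  fix \<mu> assume "\<mu> \<in> hardy2_spectrum T"
  then show "\<mu> \<in> insert 0 (range \<Lambda>)"
    using T_minus_invertible[of \<mu>] unfolding hardy2_spectrum_def by blast
next
  fix \<mu> assume "\<mu> \<in> insert 0 (range \<Lambda>)"
  \<comment> \<open>Indices with \<open>\<Lambda> n = 0\<close> fall under the first case, because
    the argument for eigenvalues divides the moduli into distinct powers only when
    \<open>\<Lambda> n\<close> is nonzero.\<close>
  then consider "\<mu> = 0" | n where "\<mu> = \<Lambda> n" "\<Lambda> n \<noteq> 0" by auto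
  then show "\<mu> \<in> hardy2_spectrum T"
    using T_not_invertible T_minus_eigenvalue_not_invertible
    by cases (auto simp: hardy2_spectrum_def)
qed

theorem spectral_radius: "hardy2_spectral_radius T = cmod (u w)"
  unfolding hardy2_spectral_radius_def spectrum
proof (rule cSup_eq_maximum)
  show "cmod (u w) \<in> cmod ` insert 0 (range \<Lambda>)" by (force simp: \<Lambda>_def image_iff intro: exI[of _ 0])
  have "cmod (\<Lambda> n) \<le> cmod (u w)" for n
    using deriv_less_1 by (simp add: \<Lambda>_def norm_mult norm_power mult_left_le power_le_one)
  then show "x \<le> cmod (u w)" if "x \<in> cmod ` insert 0 (range \<Lambda>)" for x
    using that by auto
qed

end

section \<open>Linear fractional self-maps of the disk\<close>

text \<open>Conjugation by the Moebius map moves \<open>w\<close> to 0. The closed disk has compact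
  image inside the open disk, so the conjugated map stays below some \<open>r < 1\<close>, and the
  Schwarz lemma applies to it after division by \<open>r\<close>.\<close>

lemma Moebius_contraction:
  assumes hol: "\<sigma> holomorphic_on unit_disk" and cont: "continuous_on (cball 0 1) \<sigma>"
    and less: "\<And>z. cmod z \<le> 1 \<Longrightarrow> cmod (\<sigma> z) < 1" and w: "cmod w < 1" "\<sigma> w = w"
  obtains r where "0 < r" "r < 1" "\<And>z. cmod z < 1 \<Longrightarrow>
    cmod (Moebius_function 0 w (\<sigma> z)) \<le> r * cmod (Moebius_function 0 w z)"
proof -
  let ?m = "Moebius_function 0 w" and ?m' = "Moebius_function 0 (- w)"
  have m_less: "cmod (?m z) < 1" "cmod (?m' z) < 1" if "cmod z < 1" for z
    using Moebius_function_norm_lt_1 w that by simp_all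
  have m_hol: "?m holomorphic_on unit_disk" "?m' holomorphic_on unit_disk"
    using Moebius_function_holomorphic w by simp_all
  have "continuous_on (cball 0 1) (\<lambda>z. cmod (?m (\<sigma> z)))"
    by (intro continuous_on_norm continuous_on_compose2[OF holomorphic_on_imp_continuous_on[OF m_hol(1)] cont])
       (use less in auto)
  then obtain z0 where z0: "z0 \<in> cball 0 1" "\<And>z. z \<in> cball 0 1 \<Longrightarrow> cmod (?m (\<sigma> z)) \<le> cmod (?m (\<sigma> z0))"
    using continuous_attains_sup[of "cball 0 1" "\<lambda>z. cmod (?m (\<sigma> z))"] by auto
  have "cmod (?m (\<sigma> z0)) < 1" using z0 less by (intro m_less) auto
  \<comment> \<open>Strictly above the maximum: this makes \<open>r\<close> positive and the
    rescaled map strictly less than 1 in modulus, as the Schwarz lemma requires.\<close>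
  then obtain r where r: "cmod (?m (\<sigma> z0)) < r" "r < 1" using dense by blast
  have r0: "r > 0" using order_le_less_trans[OF norm_ge_zero r(1)] .
  define F where "F = (\<lambda>y. ?m (\<sigma> (?m' y)) / r)"
  have "(\<lambda>y. \<sigma> (?m' y)) holomorphic_on unit_disk"
    using holomorphic_on_compose_gen[OF m_hol(2) hol] m_less by (auto simp: o_def image_subset_iff)
  then have "(\<lambda>y. ?m (\<sigma> (?m' y))) holomorphic_on unit_disk"
    using holomorphic_on_compose_gen[OF _ m_hol(1), of "\<lambda>y. \<sigma> (?m' y)" unit_disk] m_less less
    by (auto simp: o_def image_subset_iff less_imp_le)
  then have F_hol: "F holomorphic_on unit_disk"
    unfolding F_def using r0 by (intro holomorphic_intros) auto
  have F_0: "F 0 = 0"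
    using w by (simp add: F_def Moebius_function_simple)
  have F_less: "cmod (F y) < 1" if "cmod y < 1" for y
    using z0(2)[of "?m' y"] m_less(2)[OF that] r r0 by (simp add: F_def norm_divide field_simps)
  have "cmod (?m (\<sigma> z)) \<le> r * cmod (?m z)" if z: "cmod z < 1" for z
  proof -
    have "?m' (?m z) = z" using Moebius_function_compose[of "- w" w z] w z by simp
    then have "cmod (?m (\<sigma> z)) = r * cmod (F (?m z))" using r0 by (simp add: F_def norm_divide)
    also have "\<dots> \<le> r * cmod (?m z)"
      using Schwarz_Lemma(1)[OF F_hol F_0 F_less m_less(1)[OF z]] r0 by (intro mult_left_mono) auto
    finally show ?thesis .
  qed
  then show ?thesis using that r0 r(2) by blast
qed

text \<open>On the circle \<open>A + 2 Re (B z)\<close> has minimum \<open>A - 2 |B|\<close>, attained at one point only unless \<open>B = 0\<close>.\<close>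

lemma circle_affine_two_zeros:
  assumes nonneg: "\<And>z. cmod z = 1 \<Longrightarrow> A + 2 * Re (B * z) \<ge> 0"
    and z: "cmod \<zeta> = 1" "A + 2 * Re (B * \<zeta>) = 0"
    and y: "cmod \<eta> = 1" "A + 2 * Re (B * \<eta>) = 0" and "\<zeta> \<noteq> \<eta>"
  shows "B = 0" "A = 0"
proof -
  show B: "B = 0"
  proof (rule ccontr)
    assume B: "B \<noteq> 0"
    \<comment> \<open>The point of the circle where Re (B * z) attains its minimum - |B|.\<close>
    define z0 where "z0 = - cnj B / cmod B"
    have "cmod z0 = 1" using B by (simp add: z0_def norm_divide)
    moreover have "B * z0 = - of_real (cmod B)"
    proof -
      have "B * z0 = - (B * cnj B) / cmod B" by (simp add: z0_def)
      also have "B * cnj B = of_real (cmod B) * of_real (cmod B)"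
        using complex_norm_square[of B] by (simp add: power2_eq_square)
      finally show ?thesis using B by simp
    qed
    ultimately have A: "A - 2 * cmod B \<ge> 0" using nonneg[of z0] by simp
    have "B * x = - of_real (cmod B)" if x: "cmod x = 1" "A + 2 * Re (B * x) = 0" for x
    proof -
      have norm: "cmod (B * x) = cmod B" using x by (simp add: norm_mult)
      then have "Re (B * x) = - cmod B"
        using abs_Re_le_cmod[of "B * x"] A x(2) by linarith
      then have "Re (B * x) ^ 2 = cmod (B * x) ^ 2" by (simp only: norm) simp
      then have "Im (B * x) = 0" by (simp add: cmod_power2 del: times_complex.sel)
      then show ?thesis using \<open>Re (B * x) = - cmod B\<close> by (intro complex_eqI) auto
    qed
    then have "B * \<zeta> = B * \<eta>" using z y by simp
    then show False using B \<open>\<zeta> \<noteq> \<eta>\<close> by simp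
  qed
  show "A = 0" using z(2) B by simp
qed

text \<open>On the circle the difference of the squared moduli of denominator and numerator is an
  expression \<open>A + 2 * Re (B * z)\<close>, nonnegative with two zeros, so \<open>A\<close> and
  \<open>B\<close> vanish. The difference then becomes a positive multiple of 1 - |z|^2 everywhere,
  which decides on which side of the circle a point and its image lie.\<close>

lemma linear_fractional_bij_disk:
  assumes p: "cmod p < 1" and c: "cmod c < 1" and det: "q + c * p \<noteq> 0"
    and le: "\<And>z. cmod z = 1 \<Longrightarrow> cmod (p + q * z) \<le> cmod (1 - c * z)"
    and z: "cmod \<zeta> = 1" "cmod (p + q * \<zeta>) = cmod (1 - c * \<zeta>)"
    and y: "cmod \<eta> = 1" "cmod (p + q * \<eta>) = cmod (1 - c * \<eta>)" and ne: "\<zeta> \<noteq> \<eta>"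
  shows "bij_betw (\<lambda>z. (p + q * z) / (1 - c * z)) unit_disk unit_disk"
proof -
  define B where "B = - c - cnj p * q"
  define A where "A = 1 + (cmod c)\<^sup>2 - (cmod p)\<^sup>2 - (cmod q)\<^sup>2"
  have diff: "(cmod (1 - c * z))\<^sup>2 - (cmod (p + q * z))\<^sup>2 =
      1 + (cmod c)\<^sup>2 * (cmod z)\<^sup>2 - (cmod p)\<^sup>2 - (cmod q)\<^sup>2 * (cmod z)\<^sup>2 + 2 * Re (B * z)" for z
    unfolding cmod_power2 B_def by (simp add: power2_eq_square algebra_simps)
  have circ: "(cmod (1 - c * z))\<^sup>2 - (cmod (p + q * z))\<^sup>2 = A + 2 * Re (B * z)" if "cmod z = 1" for z
    using diff[of z] that by (simp add: A_def)
  have nonneg: "A + 2 * Re (B * z) \<ge> 0" if "cmod z = 1" for z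
  proof -
    have "(cmod (p + q * z))\<^sup>2 \<le> (cmod (1 - c * z))\<^sup>2" using le[OF that] by (intro power_mono) auto
    then show ?thesis using circ[OF that] by linarith
  qed
  have AB: "B = 0" "A = 0"
    using circle_affine_two_zeros[OF nonneg z(1) _ y(1) _ ne] circ[OF z(1)] circ[OF y(1)] z(2) y(2) by simp_all
  have q2: "(cmod q)\<^sup>2 = 1 + (cmod c)\<^sup>2 - (cmod p)\<^sup>2" using AB(2) by (simp add: A_def)
  have key: "(cmod (1 - c * z))\<^sup>2 - (cmod (p + q * z))\<^sup>2 = (1 - (cmod p)\<^sup>2) * (1 - (cmod z)\<^sup>2)" for z
    using diff[of z] by (simp add: AB(1) q2 algebra_simps)
  have p2: "1 - (cmod p)\<^sup>2 > 0" using p by (simp add: abs_square_less_1)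
  have nz: "1 - c * z \<noteq> 0" if "cmod z < 1" for z
    using norm_mult_less[OF c that] by auto
  show ?thesis
    unfolding bij_betw_def
  proof (intro conjI inj_onI subset_antisym subsetI)
    fix x z assume xz: "x \<in> unit_disk" "z \<in> unit_disk" "(p + q * x) / (1 - c * x) = (p + q * z) / (1 - c * z)"
    then have eq: "(p + q * x) * (1 - c * z) = (p + q * z) * (1 - c * x)"
      using frac_eq_eq[OF nz[of x] nz[of z]] by (simp only: mem_ball_0)
    have "(q + c * p) * (x - z) = (p + q * x) * (1 - c * z) - (p + q * z) * (1 - c * x)"
      by (simp add: algebra_simps)
    also have "\<dots> = 0" unfolding eq by (rule diff_self)
    finally have "(q + c * p) * (x - z) = 0" .
    then show "x = z" using det by simp
  next
    fix v assume "v \<in> (\<lambda>z. (p + q * z) / (1 - c * z)) ` unit_disk"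
    then obtain z where z: "cmod z < 1" "v = (p + q * z) / (1 - c * z)" by auto
    have "(1 - (cmod p)\<^sup>2) * (1 - (cmod z)\<^sup>2) > 0"
      using p2 z(1) by (intro mult_pos_pos) (simp_all add: abs_square_less_1)
    then have "(cmod (p + q * z))\<^sup>2 < (cmod (1 - c * z))\<^sup>2" using key[of z] by linarith
    then have "cmod (p + q * z) < cmod (1 - c * z)" by (rule power2_less_imp_less) simp
    moreover have "0 < cmod (1 - c * z)" using nz[OF z(1)] by (rule zero_less_norm_iff[THEN iffD2])
    ultimately show "v \<in> unit_disk" unfolding z(2) by (simp only: mem_ball_0 norm_divide divide_less_eq_1_pos)
  next
    fix v assume "v \<in> unit_disk"
    then have v: "cmod v < 1" by simp
    \<comment> \<open>This keeps the pole of the inverse map outside the disk.\<close>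
    have "(cmod c)\<^sup>2 < (cmod q)\<^sup>2" using q2 p2 by linarith
    then have "cmod c < cmod q" by (rule power2_less_imp_less) simp
    moreover have "cmod (c * v) \<le> cmod c" using v by (simp add: norm_mult mult_left_le)
    ultimately have "cmod q \<noteq> cmod (- (c * v))" by simp
    then have qv: "q + c * v \<noteq> 0" unfolding add_eq_0_iff2 by blast
    define z where "z = (v - p) / (q + c * v)"
    have "z * (q + c * v) = v - p" using qv by (simp add: z_def)
    then have eq: "p + q * z = v * (1 - c * z)" by (simp add: algebra_simps)
    \<comment> \<open>Numerator and denominator cannot vanish together, by the determinant
      condition.\<close>
    have nz': "1 - c * z \<noteq> 0"
    proof
      assume 0: "1 - c * z = 0"
      have "p + q * z = 0" using eq unfolding 0 by simp
      moreover have "(q + c * p) * z = (p + q * z) - p * (1 - c * z)" by (simp add: algebra_simps)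
      ultimately have "z = 0" unfolding 0 using det by simp
      then show False using 0 by simp
    qed
    \<comment> \<open>The identity \<open>key\<close> is read backwards: the sign of 1 - |v|^2
      determines that of 1 - |z|^2.\<close>
    have "(cmod (p + q * z))\<^sup>2 = (cmod v)\<^sup>2 * (cmod (1 - c * z))\<^sup>2"
      by (simp add: eq norm_mult power_mult_distrib)
    then have "(1 - (cmod p)\<^sup>2) * (1 - (cmod z)\<^sup>2) = (1 - (cmod v)\<^sup>2) * (cmod (1 - c * z))\<^sup>2"
      using key[of z] by (simp add: algebra_simps)
    moreover have "(1 - (cmod v)\<^sup>2) * (cmod (1 - c * z))\<^sup>2 > 0"
      using v nz' by (intro mult_pos_pos) (simp_all add: abs_square_less_1)
    ultimately have "(1 - (cmod p)\<^sup>2) * (1 - (cmod z)\<^sup>2) > 0" by (simp only:)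
    then have "1 - (cmod z)\<^sup>2 > 0" using p2 by (rule zero_less_mult_pos)
    then have "z \<in> unit_disk" by (simp add: abs_square_less_1)
    moreover have "v = (p + q * z) / (1 - c * z)"
      by (rule nonzero_eq_divide_eq[OF nz', THEN iffD2]) (rule eq[symmetric])
    ultimately show "v \<in> (\<lambda>z. (p + q * z) / (1 - c * z)) ` unit_disk" by (rule rev_image_eqI)
  qed
qed

text \<open>The point 0 is listed separately: if \<open>b\<close> and \<open>a1\<close> are nonzero,
  no term of the sequence is 0, yet the operator is not invertible.\<close>

theorem proposition3p8:
  fixes a0 a1 b l :: complex and \<psi> \<phi> :: "complex \<Rightarrow> complex"
  assumes a0: "a0 \<in> unit_disk"
    and psi: "\<psi> = (\<lambda>z. b / (1 - a0 * z))"
    and phi: "\<phi> = (\<lambda>z. a0 + a1 * z / (1 - a0 * z))"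
    and self_map: "analytic_self_map \<phi>"
    and not_auto: "\<not> disk_automorphism \<phi>"
    and l: "cmod l = 1"
    and no_fix: "\<And>\<zeta>. \<zeta> \<in> sphere 0 1 \<Longrightarrow> \<phi> (l * \<zeta>) \<noteq> \<zeta>"
  shows "(\<exists>w\<in>unit_disk. \<phi> (l * w) = w) \<and>
    (\<forall>w\<in>unit_disk. \<phi> (l * w) = w \<longrightarrow>
      hardy2_spectrum (weighted_comp (\<lambda>z. \<psi> (l * z)) (\<lambda>z. \<phi> (l * z))) =
        insert 0 {\<psi> (l * w) * (l * deriv \<phi> (l * w)) ^ n | n :: nat. True} \<and>
      hardy2_spectral_radius (weighted_comp (\<lambda>z. \<psi> (l * z)) (\<lambda>z. \<phi> (l * z))) =
        cmod (\<psi> (l * w)))"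
proof -
  define \<tau> where "\<tau> = (\<lambda>z. \<phi> (l * z))"
  define u where "u = (\<lambda>z. \<psi> (l * z))"
  have a0_less: "cmod a0 < 1" using a0 by simp
  have nz: "1 - a0 * z \<noteq> 0" if "cmod z \<le> 1" for z
  proof -
    have "cmod (a0 * z) \<le> cmod a0 * 1" unfolding norm_mult using that by (intro mult_left_mono) auto
    then show ?thesis using a0_less by auto
  qed
  \<comment> \<open>The form required by \<open>linear_fractional_bij_disk\<close>, with
    \<open>p\<close> and \<open>c\<close> both equal to \<open>a0\<close>.\<close>
  have phi_frac: "\<phi> z = (a0 + (a1 - a0\<^sup>2) * z) / (1 - a0 * z)" if "cmod z \<le> 1" for z
    unfolding phi using nz[OF that] by (simp add: divide_simps) (simp add: algebra_simps power2_eq_square)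
  have phi_hol: "\<phi> holomorphic_on unit_disk" and phi_less: "\<And>z. cmod z < 1 \<Longrightarrow> cmod (\<phi> z) < 1"
    using self_map by (auto simp: analytic_self_map_def image_subset_iff)
  have phi_cont: "continuous_on (cball 0 1) \<phi>"
    unfolding phi by (intro continuous_intros) (use nz in auto)
  have phi_le: "cmod (\<phi> z) \<le> 1" if "cmod z \<le> 1" for z
  proof -
    have "\<phi> ` closure unit_disk \<subseteq> cball 0 1"
      by (rule image_closure_subset) (use phi_cont phi_less in \<open>auto simp: less_imp_le\<close>)
    then have "\<phi> ` cball 0 1 \<subseteq> cball 0 1" by simp
    then show ?thesis using that by (auto simp: image_subset_iff)
  qed

  have two_contacts: "\<zeta> = \<eta>"
    if "cmod \<zeta> = 1" "cmod (\<phi> \<zeta>) = 1" "cmod \<eta> = 1" "cmod (\<phi> \<eta>) = 1" for \<zeta> \<eta>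
  proof (rule ccontr)
    assume ne: "\<zeta> \<noteq> \<eta>"
    have frac: "cmod (\<phi> z) = cmod (a0 + (a1 - a0\<^sup>2) * z) / cmod (1 - a0 * z)" "cmod (1 - a0 * z) > 0"
      if "cmod z = 1" for z
      using phi_frac[of z] nz[of z] that by (auto simp: norm_divide)
    \<comment> \<open>The determinant is \<open>a1\<close>; if it were 0, \<open>\<phi>\<close>
      would be the constant \<open>a0\<close>, which lies inside the disk and touches no boundary
      point.\<close>
    have det: "a1 - a0\<^sup>2 + a0 * a0 \<noteq> 0"
    proof
      assume "a1 - a0\<^sup>2 + a0 * a0 = 0"
      then have "a1 = 0" by (simp add: power2_eq_square)
      then show False using that(2) a0_less by (simp add: phi)
    qed
    have "bij_betw (\<lambda>z. (a0 + (a1 - a0\<^sup>2) * z) / (1 - a0 * z)) unit_disk unit_disk"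
    proof (rule linear_fractional_bij_disk[OF a0_less a0_less det _ that(1) _ that(3) _ ne])
      show "cmod (a0 + (a1 - a0\<^sup>2) * z) \<le> cmod (1 - a0 * z)" if "cmod z = 1" for z
        using frac[OF that] phi_le[of z] that by (simp add: divide_le_eq_1_pos)
      show "cmod (a0 + (a1 - a0\<^sup>2) * \<zeta>) = cmod (1 - a0 * \<zeta>)" "cmod (a0 + (a1 - a0\<^sup>2) * \<eta>) = cmod (1 - a0 * \<eta>)"
        using frac[OF that(1)] frac[OF that(3)] that by (simp_all add: divide_eq_1_iff)
    qed
    then have "bij_betw \<phi> unit_disk unit_disk"
      by (rule bij_betw_cong[THEN iffD1, rotated]) (simp add: phi_frac)
    then show False using not_auto phi_hol by (simp add: disk_automorphism_def)
  qed

  have lz: "cmod (l * z) = cmod z" for z by (simp add: norm_mult l)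
  have tau_hol: "\<tau> holomorphic_on unit_disk"
    unfolding \<tau>_def using holomorphic_on_compose_gen[OF _ phi_hol, of "\<lambda>z. l * z" unit_disk] lz
    by (auto simp: o_def image_subset_iff intro!: holomorphic_intros)
  have tau_cont: "continuous_on (cball 0 1) \<tau>"
    unfolding \<tau>_def by (rule continuous_on_compose2[OF phi_cont]) (auto intro!: continuous_intros simp: lz)
  have tau_less: "cmod (\<tau> z) < 1" if "cmod z < 1" for z
    unfolding \<tau>_def by (rule phi_less) (simp add: lz that)
  have tau_le: "cmod (\<tau> z) \<le> 1" if "cmod z \<le> 1" for z
    unfolding \<tau>_def by (rule phi_le) (simp add: lz that)
  have tau_self: "analytic_self_map \<tau>"
    using tau_hol tau_less by (auto simp: analytic_self_map_def)

  have iter_less: "cmod (\<tau> (\<tau> z)) < 1" if z: "cmod z \<le> 1" for z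
  proof (rule ccontr)
    assume "\<not> cmod (\<tau> (\<tau> z)) < 1"
    then have tt: "cmod (\<tau> (\<tau> z)) = 1" using tau_le[OF tau_le[OF z]] by simp
    then have t1: "cmod (\<tau> z) = 1" using tau_less[of "\<tau> z"] tau_le[OF z] by force
    then have z1: "cmod z = 1" using tau_less[of z] z by force
    \<comment> \<open>Both points lie on the circle and are sent to it by \<open>\<phi>\<close>.
      Uniqueness of contact makes \<open>z\<close> a fixed point of \<open>\<tau>\<close> on the
      circle, which is excluded.\<close>
    have "l * z = l * \<tau> z"
      by (rule two_contacts) (use tt t1 z1 in \<open>simp_all add: lz flip: \<tau>_def\<close>, simp_all add: \<tau>_def)
    then have "\<phi> (l * z) = z" using l by (auto simp: \<tau>_def)
    then show False using no_fix[of z] z1 by simp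
  qed
  have iter_cont: "continuous_on (cball 0 1) (\<lambda>z. \<tau> (\<tau> z))"
    by (rule continuous_on_compose2[OF tau_cont tau_cont]) (use tau_le in auto)
  have iter_hol: "(\<lambda>z. \<tau> (\<tau> z)) holomorphic_on unit_disk"
    using holomorphic_on_compose_gen[OF tau_hol tau_hol] tau_less by (auto simp: o_def image_subset_iff)
  obtain s where s: "s < 1" "\<And>z. cmod z < 1 \<Longrightarrow> cmod (\<tau> (\<tau> z)) \<le> s"
  proof -
    have "continuous_on (cball 0 1) (\<lambda>z. cmod (\<tau> (\<tau> z)))" by (intro continuous_on_norm iter_cont)
    then obtain z0 where "z0 \<in> cball 0 1" "\<And>z. z \<in> cball 0 1 \<Longrightarrow> cmod (\<tau> (\<tau> z)) \<le> cmod (\<tau> (\<tau> z0))"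
      using continuous_attains_sup[of "cball 0 1" "\<lambda>z. cmod (\<tau> (\<tau> z))"] by auto
    then show ?thesis using that[of "cmod (\<tau> (\<tau> z0))"] iter_less[of z0] by auto
  qed

  have ex: "\<exists>w\<in>unit_disk. \<phi> (l * w) = w"
  proof -
    \<comment> \<open>Brouwer's theorem gives a fixed point in the closed disk, and
      \<open>no_fix\<close> keeps it off the circle.\<close>
    obtain w where w: "w \<in> cball 0 1" "\<tau> w = w"
      using brouwer[of "cball 0 1" \<tau>] tau_cont tau_le by auto
    then have "w \<notin> sphere 0 1" using no_fix by (auto simp: \<tau>_def)
    then show ?thesis using w by (auto simp: \<tau>_def)
  qed

  have u_hol: "u holomorphic_on unit_disk"
    unfolding u_def psi using nz lz by (auto intro!: holomorphic_intros simp: less_imp_le)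
  have u_bound: "cmod (u z) \<le> cmod b / (1 - cmod a0)" if "cmod z < 1" for z
  proof -
    have "cmod (a0 * (l * z)) \<le> cmod a0 * 1"
      unfolding norm_mult[of a0] lz using that by (intro mult_left_mono) auto
    then have "1 - cmod a0 \<le> cmod (1 - a0 * (l * z))"
      using norm_triangle_ineq2[of 1 "a0 * (l * z)"] by simp
    then show ?thesis unfolding u_def psi norm_divide using a0_less by (intro divide_left_mono mult_pos_pos) auto
  qed

  have main: "hardy2_spectrum (weighted_comp u \<tau>) = insert 0 {\<psi> (l * w) * (l * deriv \<phi> (l * w)) ^ n | n :: nat. True} \<and>
      hardy2_spectral_radius (weighted_comp u \<tau>) = cmod (\<psi> (l * w))"
    if w: "w \<in> unit_disk" "\<phi> (l * w) = w" for w
  proof -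
    have w1: "cmod w < 1" and fix_w: "\<tau> w = w" using w by (auto simp: \<tau>_def)
    then have "\<tau> (\<tau> w) = w" by simp
    then obtain r where r: "0 < r" "r < 1" "\<And>z. cmod z < 1 \<Longrightarrow>
      cmod (Moebius_function 0 w (\<tau> (\<tau> z))) \<le> r * cmod (Moebius_function 0 w z)"
      using Moebius_contraction[OF iter_hol iter_cont iter_less w1] by blast
    interpret contractive_weighted_comp u \<tau> w "cmod b / (1 - cmod a0)" r s
      by unfold_locales (use u_hol u_bound tau_self w1 fix_w s r in auto)
    have "(\<phi> has_field_derivative deriv \<phi> (l * w)) (at (l * w))"
      using phi_hol w1 lz[of w] by (intro holomorphic_derivI[of _ unit_disk]) auto
    then have "(\<tau> has_field_derivative deriv \<phi> (l * w) * l) (at w)"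
      unfolding \<tau>_def by (rule DERIV_chain2) (auto intro!: derivative_eq_intros)
    then have "deriv \<tau> w = l * deriv \<phi> (l * w)" by (simp add: DERIV_imp_deriv mult.commute)
    moreover have uw: "u w = \<psi> (l * w)" by (simp add: u_def)
    ultimately have "\<Lambda> = (\<lambda>n. \<psi> (l * w) * (l * deriv \<phi> (l * w)) ^ n)"
      by (simp add: \<Lambda>_def fun_eq_iff)
    then have "range \<Lambda> = {\<psi> (l * w) * (l * deriv \<phi> (l * w)) ^ n | n :: nat. True}" by auto
    then show ?thesis using spectrum spectral_radius uw by simp
  qed
  show ?thesis using ex main unfolding u_def \<tau>_def by blast
qed

end
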